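(* Let $V$ be a discrete valuation domain with finite residue field and quotient field $K$. Suppose that $K$ admits a valuation ring $W$ that is independent from $V$ and such that either the maximal ideal of $W$ is non-zero and principal, or the residue field of $W$ is finite. Let $k$ be a positive integer and let $1 < n_1 \leq \ldots \leq n_k$ be integers. Then there exists $H \in \operatorname{Int}(V)$ which has precisely $k$ essentially different factorizations into irreducible elements of $\operatorname{Int}(V)$, and the lengths of these $k$ factorizations (counted with multiplicity, in a suitable order) are exactly $n_1,\ldots,n_k$.
   Context: For an integral domain $R$ with quotient field $K$, $\operatorname{Int}(R)=\{f\in K[X]\mid f(R)\subseteq R\}$ is the ring of integer-valued polynomials on $R$ (a subring of $K[X]$). A discrete valuation domain is the valuation ring of a valuation on a field with value group isomorphic to $\mathbb{Z}$ (rank one, not a field). A valuation ring of a field $K$ is the valuation ring of a valuation $\mathsf v:K^\times\to G$ into a totally ordered abelian group $G$ (of arbitrary rank), i.e. $\{0\}\cup\{x\in K^\times \mid \mathsf v(x)\ge 0\}$. Two valuation rings $V,W$ of $K$ are independent if the smallest subring of $K$ containing both is $K$ itself. An element $r$ of an integral domain $R$ is irreducible if it is a non-zero non-unit that is not the product of two non-units of $R$. A factorization of $r$ is a decomposition $r=a_1\cdots a_n$ into irreducible elements of $R$; $n$ is its length. Two factorizations $r=a_1\cdots a_n=u_1\cdots u_m$ are essentially the same if $n=m$ and, after re-indexing, $u_i=\varepsilon_i a_i$ with a unit $\varepsilon_i\in R$ for all $i$; otherwise they are essentially different. *)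

theory Defs
  imports "HOL-Algebra.Algebra" "HOL-Algebra.Algebraic_Closure_Type"
    "HOL-Computational_Algebra.Polynomial"
begin

text \<open>
  The ambient field is a type of class \<open>field\<close>, and rings inside it (or inside its polynomial
  ring) are sets, viewed as HOL-Algebra structures by restricting the carrier of the full ring.
\<close>

abbreviation ring_on :: "'a::ring_1 set \<Rightarrow> 'a ring"
  where "ring_on S \<equiv> ring_of_type_algebra\<lparr>carrier := S\<rparr>"


subsection \<open>Valuation rings\<close>

text \<open>
  Valuations are written additively and are maps on the non-zero elements; the value at \<open>0\<close> is
  arbitrary and never used. The value group is the image of the non-zero elements, which is a
  subgroup of the type \<open>'g\<close> and need not be all of it.
\<close>

definition valuation :: "('a::Fields.field \<Rightarrow> 'g::linordered_ab_group_add) \<Rightarrow> bool" where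
  "valuation v \<longleftrightarrow>
     (\<forall>x y. x \<noteq> 0 \<longrightarrow> y \<noteq> 0 \<longrightarrow> v (x * y) = v x + v y) \<and>
     (\<forall>x y. x \<noteq> 0 \<longrightarrow> y \<noteq> 0 \<longrightarrow> x + y \<noteq> 0 \<longrightarrow> min (v x) (v y) \<le> v (x + y))"

definition valuation_ring :: "('a::Fields.field \<Rightarrow> 'g::linordered_ab_group_add) \<Rightarrow> 'a set" where
  "valuation_ring v = {0} \<union> {x. x \<noteq> 0 \<and> 0 \<le> v x}"

text \<open>
  A value group isomorphic to the integers is transported along the (order-preserving)
  isomorphism, so that the valuation takes values in \<open>int\<close> and is onto.
\<close>

definition discrete_valuation_domain :: "'a::Fields.field set \<Rightarrow> bool" where
  "discrete_valuation_domain V \<longleftrightarrow>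
     (\<exists>v :: 'a \<Rightarrow> int. valuation v \<and> v ` (UNIV - {0}) = UNIV \<and> V = valuation_ring v)"

definition independent_valuation_rings :: "'a::Fields.field set \<Rightarrow> 'a set \<Rightarrow> bool" where
  "independent_valuation_rings V W \<longleftrightarrow> generate_ring (ring_on UNIV) (V \<union> W) = UNIV"


subsection \<open>Integer-valued polynomials\<close>

text \<open>
  This is meant for a subring \<open>R\<close> of the field type whose quotient field is the whole type;
  valuation rings of the field have this property.
\<close>

definition Int_poly :: "'a::Fields.field set \<Rightarrow> 'a Polynomial.poly set" where
  "Int_poly R = {f. \<forall>x\<in>R. Polynomial.poly f x \<in> R}"


subsection \<open>Factorizations\<close>

text \<open>
  Factorizations are lists of irreducible elements; the length of the factorization is the length
  of the list. Being essentially the same is the library's \<open>essentially_equal\<close>. The lemmas at the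
  end of the theory spell out both library notions in terms of units and products.
\<close>

definition factorization :: "('a, 'b) ring_scheme \<Rightarrow> 'a list \<Rightarrow> 'a \<Rightarrow> bool" where
  "factorization R as r \<longleftrightarrow>
     set as \<subseteq> carrier R \<and> (\<forall>a\<in>set as. ring_irreducible\<^bsub>R\<^esub> a) \<and>
     foldr (\<otimes>\<^bsub>R\<^esub>) as \<one>\<^bsub>R\<^esub> = r"

text \<open>
  The factorizations \<open>F 1, \<dots>, F k\<close> form a complete system of representatives of the
  factorizations of \<open>r\<close> up to being essentially the same.
\<close>

definition essentially_distinct_factorizations ::
    "('a, 'b) ring_scheme \<Rightarrow> 'a \<Rightarrow> nat \<Rightarrow> (nat \<Rightarrow> 'a list) \<Rightarrow> bool" where
  "essentially_distinct_factorizations R r k F \<longleftrightarrow>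
     (\<forall>i\<in>{1..k}. factorization R (F i) r) \<and>
     (\<forall>i\<in>{1..k}. \<forall>j\<in>{1..k}. i \<noteq> j \<longrightarrow> \<not> essentially_equal R (F i) (F j)) \<and>
     (\<forall>as. factorization R as r \<longrightarrow> (\<exists>i\<in>{1..k}. essentially_equal R as (F i)))"


subsection \<open>Basic facts\<close>

lemma (in domain) ring_irreducible_iff:
  assumes "r \<in> carrier R"
  shows "ring_irreducible r \<longleftrightarrow>
    r \<noteq> \<zero> \<and> r \<notin> Units R \<and>
    \<not> (\<exists>a\<in>carrier R. \<exists>b\<in>carrier R. a \<notin> Units R \<and> b \<notin> Units R \<and> r = a \<otimes> b)"
  using ring_irreducibleE[OF assms] ring_irreducibleI[of r] assms by blast

lemma (in domain) associated_iff_unit: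
  assumes "a \<in> carrier R" "u \<in> carrier R"
  shows "a \<sim> u \<longleftrightarrow> (\<exists>e\<in>Units R. u = e \<otimes> a)"
proof
  assume "a \<sim> u"
  then obtain c d where c: "c \<in> carrier R" "u = a \<otimes> c" and d: "d \<in> carrier R" "a = u \<otimes> d"
    unfolding associated_def factor_def by blast
  show "\<exists>e\<in>Units R. u = e \<otimes> a"
  proof (cases "a = \<zero>")
    case True
    then have "u = \<one> \<otimes> a" using c by simp
    then show ?thesis by blast
  next
    case False
    have "a \<otimes> (c \<otimes> d) = a \<otimes> \<one>"
      using c d assms by (metis m_assoc r_one)
    then have "c \<otimes> d = \<one>"
      using False assms c(1) d(1) m_lcancel by blast
    then have "c \<in> Units R"
      using c(1) d(1) m_comm[of c d] unfolding Units_def by auto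
    then show ?thesis using c m_comm[OF assms(1) c(1)] by blast
  qed
next
  assume "\<exists>e\<in>Units R. u = e \<otimes> a"
  then obtain e where e: "e \<in> Units R" "u = e \<otimes> a" by blast
  then have closed: "e \<in> carrier R" "inv e \<in> carrier R" by auto
  have "u = a \<otimes> e" using e(2) closed(1) assms(1) by (simp only: m_comm)
  moreover have "a = u \<otimes> inv e"
  proof -
    have "u \<otimes> inv e = (a \<otimes> e) \<otimes> inv e" using \<open>u = a \<otimes> e\<close> by (rule arg_cong)
    also have "\<dots> = a \<otimes> (e \<otimes> inv e)" using assms(1) closed by (rule m_assoc)
    also have "\<dots> = a" using e(1) assms(1) by (simp only: Units_r_inv r_one)
    finally show ?thesis by (rule sym)
  qed
  ultimately show "a \<sim> u"
    using closed unfolding associated_def factor_def by blast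
qed

lemma (in domain) essentially_equal_iff:
  assumes "set as \<subseteq> carrier R" "set us \<subseteq> carrier R"
  shows "essentially_equal R as us \<longleftrightarrow>
    length as = length us \<and>
    (\<exists>p. p permutes {..<length as} \<and>
       (\<forall>i<length as. \<exists>e\<in>Units R. us ! i = e \<otimes> as ! p i))"
proof
  assume "essentially_equal R as us"
  then obtain bs where bs: "mset as = mset bs" "bs [\<sim>] us"
    unfolding essentially_equal_def by blast
  obtain p where p: "p permutes {..<length as}" "permute_list p as = bs"
    using mset_eq_permutation[OF bs(1)[THEN sym]] by metis
  have len: "length bs = length as" using bs(1) mset_eq_length by metis
  have "\<exists>e\<in>Units R. us ! i = e \<otimes> as ! p i" if i: "i < length as" for i
  proof -
    have "bs ! i \<sim> us ! i" using bs(2) i len by (auto simp: list_all2_conv_all_nth)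
    moreover have "bs ! i = as ! p i" using p i permute_list_nth by metis
    moreover have "p i < length as" using permutes_in_image[OF p(1)] i by blast
    then have "as ! p i \<in> carrier R" using assms(1) nth_mem by blast
    moreover have "us ! i \<in> carrier R"
      using assms(2) nth_mem[of i us] i len list_all2_lengthD[OF bs(2)] by auto
    ultimately show ?thesis using associated_iff_unit by simp
  qed
  then show "length as = length us \<and> (\<exists>p. p permutes {..<length as} \<and>
       (\<forall>i<length as. \<exists>e\<in>Units R. us ! i = e \<otimes> as ! p i))"
    using p(1) len bs(2) list_all2_lengthD by metis
next
  assume *: "length as = length us \<and> (\<exists>p. p permutes {..<length as} \<and>
       (\<forall>i<length as. \<exists>e\<in>Units R. us ! i = e \<otimes> as ! p i))"
  then obtain p where p: "p permutes {..<length as}"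
    "\<And>i. i < length as \<Longrightarrow> \<exists>e\<in>Units R. us ! i = e \<otimes> as ! p i" by blast
  have "permute_list p as ! i \<sim> us ! i" if i: "i < length as" for i
  proof -
    have "permute_list p as ! i = as ! p i" using p(1) i by (rule permute_list_nth)
    moreover have "p i < length as" using permutes_in_image[OF p(1)] i by blast
    then have "as ! p i \<in> carrier R" using assms(1) nth_mem by blast
    moreover have "us ! i \<in> carrier R" using assms(2) nth_mem[of i us] i * by auto
    ultimately show ?thesis using associated_iff_unit p(2)[OF i] by simp
  qed
  then have "permute_list p as [\<sim>] us"
    using * by (auto simp: list_all2_conv_all_nth)
  moreover have "mset as = mset (permute_list p as)"
    using p(1) by simp
  ultimately show "essentially_equal R as us"
    unfolding essentially_equal_def by blast
qed

lemma ring_on_simps [simp]: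
  "carrier (ring_on S) = S"
  "x \<otimes>\<^bsub>ring_on S\<^esub> y = x * y" "x \<oplus>\<^bsub>ring_on S\<^esub> y = x + y"
  "\<one>\<^bsub>ring_on S\<^esub> = 1" "\<zero>\<^bsub>ring_on S\<^esub> = 0"
  by (simp_all add: ring_of_type_algebra_def)

lemma ring_of_type_algebra_simps [simp]:
  "x \<otimes>\<^bsub>ring_of_type_algebra\<^esub> y = x * y" "x \<oplus>\<^bsub>ring_of_type_algebra\<^esub> y = x + y"
  "\<one>\<^bsub>ring_of_type_algebra\<^esub> = 1" "\<zero>\<^bsub>ring_of_type_algebra\<^esub> = 0"
  by (simp_all add: ring_of_type_algebra_def)

lemma ring_on_UNIV: "ring_on UNIV = ring_of_type_algebra"
  by (simp add: ring_of_type_algebra_def)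

lemma a_inv_ring_on_UNIV [simp]:
  "\<ominus>\<^bsub>ring_on UNIV\<^esub> x = - (x :: 'a::comm_ring_1)"
proof -
  interpret ring "ring_on (UNIV :: 'a set)"
    unfolding ring_on_UNIV by (rule ring_from_type_algebra)
  show ?thesis using minus_equality[of "- x" x] by simp
qed

lemma subring_ring_on_iff:
  fixes S :: "'a::comm_ring_1 set"
  shows "subring S (ring_on UNIV) \<longleftrightarrow>
    1 \<in> S \<and> (\<forall>x\<in>S. - x \<in> S) \<and> (\<forall>x\<in>S. \<forall>y\<in>S. x + y \<in> S \<and> x * y \<in> S)"
proof -
  interpret ring "ring_on (UNIV :: 'a set)"
    unfolding ring_on_UNIV by (rule ring_from_type_algebra)
  show ?thesis
  proof
    assume S: "subring S (ring_on UNIV)"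
    show "1 \<in> S \<and> (\<forall>x\<in>S. - x \<in> S) \<and> (\<forall>x\<in>S. \<forall>y\<in>S. x + y \<in> S \<and> x * y \<in> S)"
      using subringE(3,5,6,7)[OF S] unfolding ring_on_simps a_inv_ring_on_UNIV by blast
  next
    assume "1 \<in> S \<and> (\<forall>x\<in>S. - x \<in> S) \<and> (\<forall>x\<in>S. \<forall>y\<in>S. x + y \<in> S \<and> x * y \<in> S)"
    then show "subring S (ring_on UNIV)"
      by (intro subringI) (unfold ring_on_simps a_inv_ring_on_UNIV, blast+)
  qed
qed

lemma domain_ring_on:
  fixes S :: "'a::idom set"
  assumes "subring S (ring_on UNIV)"
  shows "domain (ring_on S)"
proof -
  interpret cring "ring_on (UNIV :: 'a set)"
    unfolding ring_on_UNIV by (rule cring_from_type_algebra)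
  have "domain (ring_on (UNIV :: 'a set))"
    by unfold_locales auto
  then show ?thesis
    using domain.subring_is_domain[OF _ assms] by simp
qed

lemma valuation_1:
  assumes "valuation v"
  shows "v 1 = 0" "v (- 1) = 0"
proof -
  have mult: "v (x * y) = v x + v y" if "x \<noteq> 0" "y \<noteq> 0" for x y
    using assms that unfolding valuation_def by blast
  show 1: "v 1 = 0" using mult[of 1 1] by simp
  show "v (- 1) = 0" using mult[of "- 1" "- 1"] 1 by simp
qed

lemma subring_valuation_ring:
  assumes "valuation v"
  shows "subring (valuation_ring v) (ring_on UNIV)"
proof -
  have mult: "v (x * y) = v x + v y" if "x \<noteq> 0" "y \<noteq> 0" for x y
    using assms that unfolding valuation_def by blast
  have add: "min (v x) (v y) \<le> v (x + y)" if "x \<noteq> 0" "y \<noteq> 0" "x + y \<noteq> 0" for x y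
    using assms that unfolding valuation_def by blast
  have "v (- x) = v x" if "x \<noteq> 0" for x
    using mult[of "- 1" x] that valuation_1[OF assms] by simp
  moreover have "0 \<le> v (x + y)" if "x \<noteq> 0" "y \<noteq> 0" "x + y \<noteq> 0" "0 \<le> v x" "0 \<le> v y" for x y
    using add[OF that(1-3)] that(4,5) by (meson min.boundedI order_trans)
  ultimately show ?thesis
    unfolding subring_ring_on_iff valuation_ring_def
    using valuation_1[OF assms] mult by auto
qed

lemma maximalideal_valuation_ring_iff:
  assumes "valuation v"
  shows "maximalideal M (ring_on (valuation_ring v)) \<longleftrightarrow> M = {0} \<union> {x. x \<noteq> 0 \<and> 0 < v x}"
proof -
  let ?V = "valuation_ring v" and ?N = "{0} \<union> {x. x \<noteq> 0 \<and> 0 < v x}"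
  interpret domain "ring_on ?V"
    by (rule domain_ring_on[OF subring_valuation_ring[OF assms]])
  have mult: "v (x * y) = v x + v y" if "x \<noteq> 0" "y \<noteq> 0" for x y
    using assms that unfolding valuation_def by blast
  have add: "min (v x) (v y) \<le> v (x + y)" if "x \<noteq> 0" "y \<noteq> 0" "x + y \<noteq> 0" for x y
    using assms that unfolding valuation_def by blast
  have neg: "v (- x) = v x" if "x \<noteq> 0" for x
    using mult[of "- 1" x] that valuation_1[OF assms] by simp
  have inv: "v (inverse x) = - v x" if "x \<noteq> 0" for x
    using mult[of x "inverse x"] that valuation_1[OF assms] by (simp add: eq_neg_iff_add_eq_0 add.commute)
  have subset: "?N \<subseteq> ?V" by (auto simp: valuation_ring_def)
  have one: "1 \<in> ?V" "1 \<notin> ?N" using valuation_1[OF assms] by (auto simp: valuation_ring_def)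
  have minus: "\<ominus>\<^bsub>ring_on ?V\<^esub> x = - x" if "x \<in> ?N" for x
    using minus_equality[of "- x" x] that neg by (auto simp: valuation_ring_def)
  have sum: "x + y \<in> ?N" if "x \<in> ?N" "y \<in> ?N" for x y
    using that add[of x y] by (auto simp: min_def split: if_splits)
  have prod: "y * x \<in> ?N" if "x \<in> ?N" "y \<in> ?V" for x y
    using that mult[of y x] by (auto simp: valuation_ring_def add_nonneg_pos)
  have ideal: "ideal ?N (ring_on ?V)"
  proof (rule idealI)
    show "subgroup ?N (add_monoid (ring_on ?V))"
    proof (rule add.subgroupI)
      show "\<ominus>\<^bsub>ring_on ?V\<^esub> x \<in> ?N" if "x \<in> ?N" for x
        unfolding minus[OF that] using that neg by auto
      show "x \<oplus>\<^bsub>ring_on ?V\<^esub> y \<in> ?N" if "x \<in> ?N" "y \<in> ?N" for x y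
        unfolding ring_on_simps using that by (rule sum)
    qed (use subset in auto)
    show "y \<otimes>\<^bsub>ring_on ?V\<^esub> x \<in> ?N" if "x \<in> ?N" "y \<in> carrier (ring_on ?V)" for x y
      using prod[OF that(1), of y] that(2) unfolding ring_on_simps by blast
    show "x \<otimes>\<^bsub>ring_on ?V\<^esub> y \<in> ?N" if "x \<in> ?N" "y \<in> carrier (ring_on ?V)" for x y
      using prod[OF that(1), of y] that(2) unfolding ring_on_simps mult.commute[of x y] by blast
  qed (rule ring_axioms)
  have proper: "J \<subseteq> ?N" if J: "ideal J (ring_on ?V)" "J \<noteq> ?V" for J
  proof
    interpret J: ideal J "ring_on ?V" by fact
    fix x assume x: "x \<in> J"
    show "x \<in> ?N"
    proof (rule ccontr)
      assume "x \<notin> ?N"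
      moreover have "x \<in> ?V" using x J.Icarr by simp
      ultimately have *: "x \<noteq> 0" "v x = 0" by (auto simp: valuation_ring_def)
      then have "inverse x \<in> ?V" using inv by (simp add: valuation_ring_def)
      then have "1 \<in> J" using J.I_l_closed[OF x, of "inverse x"] * by simp
      then show False using J.one_imp_carrier J(2) by simp
    qed
  qed
  have "maximalideal ?N (ring_on ?V)"
  proof (rule maximalidealI[OF ideal])
    show "carrier (ring_on ?V) \<noteq> ?N" using one by auto
    show "J = ?N \<or> J = carrier (ring_on ?V)"
      if "ideal J (ring_on ?V)" "?N \<subseteq> J" "J \<subseteq> carrier (ring_on ?V)" for J
      using proper[OF that(1)] that(2) by auto
  qed
  moreover have "M = ?N" if "maximalideal M (ring_on ?V)"
  proof -
    interpret M: maximalideal M "ring_on ?V" by fact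
    have "M \<subseteq> ?N" using proper[OF M.is_ideal] M.I_notcarr by auto
    moreover have "?N \<noteq> ?V" using one by blast
    ultimately show ?thesis using M.I_maximal[OF ideal] subset unfolding ring_on_simps by blast
  qed
  ultimately show ?thesis by blast
qed

lemma subring_Int_poly:
  assumes "subring R (ring_on UNIV)"
  shows "subring (Int_poly R) (ring_on UNIV)"
  using assms unfolding subring_ring_on_iff Int_poly_def by auto

lemma domain_Int_poly:
  assumes "subring R (ring_on UNIV)"
  shows "domain (ring_on (Int_poly R))"
  using domain_ring_on[OF subring_Int_poly[OF assms]] .

end

theory Submission
  imports Defs "HOL-Computational_Algebra.Polynomial_Factorial"
begin

text \<open>
Write \<open>v\<close> for the normalized valuation of \<open>V\<close>, \<open>\<pi>\<close> for an element of value \<open>1\<close> and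
\<open>\<O>\<close>, \<open>\<MM>\<close> for a valuation ring and its maximal ideal.

The idea is to let irreducible polynomials of \<open>K[X]\<close> play the part of the vertices of a graph.
Take a vertex set \<open>A\<close> that is partitioned into \<open>k\<close> groups, the \<open>j\<close>-th of size \<open>n j - 1\<close>, join two
vertices by an edge whenever they lie in different groups, and add one extra vertex \<open>c\<close>. Suppose
there are pairwise non-associated irreducible polynomials \<open>f i\<close> of \<open>K[X]\<close>, all in \<open>Int(V)\<close>, such
that for a set \<open>S\<close> of vertices the product of the \<open>f i\<close> with \<open>i \<in> S\<close> takes all its values in \<open>\<MM>\<close>
exactly if \<open>S\<close> is a cover: it contains \<open>c\<close> and an end point of every edge. Suppose further that
the product \<open>G\<close> of all \<open>f i\<close> takes a value of valuation \<open>1\<close> at \<open>0\<close>, to which only \<open>f c\<close> contributes.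
Put \<open>H = G / \<pi>\<close>. A factor of \<open>H\<close> is a scalar times a subproduct of \<open>G\<close>, and evaluation at \<open>0\<close> shows
that the denominator \<open>\<pi>\<close> cannot be distributed: it sits entirely in the factor containing \<open>f c\<close>,
whose index set must then be a cover. In an irreducible factor this cover is minimal, and the
other factors are single \<open>f i\<close>. The minimal covers of this complete multipartite graph are
the complements of the groups, so there is one factorization for each group, and its length
is \<open>1\<close> plus the size of the group (locale \<open>vertex_cover_family\<close>).

To realize the cover condition, each edge \<open>y\<close> is attached to the shell of all \<open>x\<close> with \<open>v x = y\<close>,
and \<open>c\<close> to the remaining ball around \<open>0\<close>. So \<open>f i\<close> has to be divisible by \<open>\<pi>\<close> exactly on the
shells of the edges at \<open>i\<close>. Since the residue field of \<open>V\<close> is finite, indicator functions of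
shells can be written modulo \<open>\<MM>\<close> as integer-valued polynomials: \<open>1 - X^N\<close> detects \<open>\<MM>\<close> if all units
satisfy \<open>u^N = 1\<close> modulo \<open>\<MM>\<close>, and substituting \<open>(X^(N+1) - X) / \<pi>\<close>, which lowers positive values by
\<open>1\<close>, reaches the smaller balls (\<open>ball_indicator\<close>, \<open>cover_polynomials\<close>).

It remains to make these polynomials irreducible over \<open>K\<close>, of distinct degrees, without changing
their values on \<open>V\<close> modulo \<open>\<pi>^2\<close>. This is the purpose of \<open>W\<close>. Independence gives elements that
are close to \<open>1\<close> at one valuation and close to \<open>0\<close> at the other (\<open>separating_element\<close>), so the
coefficients can be chosen close to the desired ones at \<open>V\<close> and close to those of any given
polynomial \<open>Q\<close> over \<open>W\<close>. If \<open>Q\<close> is irreducible in a way that survives small perturbations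
(\<open>stably_irreducible\<close>), the result is irreducible. Such \<open>Q\<close> exist in arbitrarily large degrees: Eisenstein
polynomials if the maximal ideal of \<open>W\<close> is principal, and lifts of irreducible polynomials over
the residue field, of which Euclid's argument provides infinitely many, if that field is finite.
\<close>

section \<open>Valuations and their fractional ideals\<close>

definition val_ge :: "('a::Fields.field \<Rightarrow> 'g::linordered_ab_group_add) \<Rightarrow> 'g \<Rightarrow> 'a set" where
  "val_ge v g = {x. x = 0 \<or> g \<le> v x}"

definition val_pos :: "('a::Fields.field \<Rightarrow> 'g::linordered_ab_group_add) \<Rightarrow> 'a set" where
  "val_pos v = {x. x = 0 \<or> 0 < v x}"

definition coeffs_in :: "'a::zero set \<Rightarrow> 'a poly set" where
  "coeffs_in S = {p. \<forall>i. coeff p i \<in> S}"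

lemma coeffs_inD: "p \<in> coeffs_in S \<Longrightarrow> coeff p i \<in> S"
  by (simp add: coeffs_in_def)

locale valued_field =
  fixes v :: "'a::Fields.field \<Rightarrow> 'g::linordered_ab_group_add"
  assumes valuation: "valuation v"
begin

lemma val_mult: "x \<noteq> 0 \<Longrightarrow> y \<noteq> 0 \<Longrightarrow> v (x * y) = v x + v y"
  using valuation unfolding valuation_def by blast

lemma val_add: "x \<noteq> 0 \<Longrightarrow> y \<noteq> 0 \<Longrightarrow> x + y \<noteq> 0 \<Longrightarrow> min (v x) (v y) \<le> v (x + y)"
  using valuation unfolding valuation_def by blast

lemmas val_one [simp] = valuation_1(1)[OF valuation]

lemma val_uminus [simp]: "v (- x) = v x"
proof (cases "x = 0")
  case False
  then show ?thesis using val_mult[of "- 1" x] valuation_1(2)[OF valuation] by simp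
qed simp

lemma val_inverse: "x \<noteq> 0 \<Longrightarrow> v (inverse x) = - v x"
  using val_mult[of x "inverse x"] by (simp add: eq_neg_iff_add_eq_0 add.commute)

lemma val_power: "x \<noteq> 0 \<Longrightarrow> v x = 0 \<Longrightarrow> v (x ^ n) = 0"
  by (induction n) (simp_all add: val_mult)

lemma valuation_ring_eq: "valuation_ring v = val_ge v 0"
  by (auto simp: valuation_ring_def val_ge_def)

abbreviation "\<O> \<equiv> val_ge v 0"
abbreviation "\<MM> \<equiv> val_pos v"

text \<open>
Submodules of the field over the valuation ring. The maximal ideal \<open>\<MM>\<close> need not have the form
\<open>val_ge v g\<close>, so this notion is what lets the closure properties be stated once for both.
\<close>

definition fractional :: "'a set \<Rightarrow> bool" where
  "fractional I \<longleftrightarrow> 0 \<in> I \<and> (\<forall>x\<in>I. \<forall>y\<in>I. x + y \<in> I) \<and> (\<forall>r\<in>\<O>. \<forall>x\<in>I. r * x \<in> I)"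

lemma val_ge_mult: "x \<in> val_ge v a \<Longrightarrow> y \<in> val_ge v b \<Longrightarrow> x * y \<in> val_ge v (a + b)"
  by (cases "x = 0 \<or> y = 0") (auto simp: val_ge_def val_mult add_mono)

lemma val_pos_mult: "x \<in> \<O> \<Longrightarrow> y \<in> \<MM> \<Longrightarrow> x * y \<in> \<MM>"
  by (cases "x = 0 \<or> y = 0") (auto simp: val_ge_def val_pos_def val_mult add_nonneg_pos)

lemma fractional_val_ge [simp]: "fractional (val_ge v g)"
proof -
  have "x + y \<in> val_ge v g" if "x \<in> val_ge v g" "y \<in> val_ge v g" for x y
    using that val_add[of x y] by (cases "x = 0 \<or> y = 0 \<or> x + y = 0") (auto simp: val_ge_def min_def split: if_splits)
  moreover have "r * x \<in> val_ge v g" if "r \<in> \<O>" "x \<in> val_ge v g" for r x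
    using val_ge_mult[OF that] by simp
  ultimately show ?thesis unfolding fractional_def by (auto simp: val_ge_def)
qed

lemma fractional_val_pos [simp]: "fractional \<MM>"
proof -
  have "x + y \<in> \<MM>" if "x \<in> \<MM>" "y \<in> \<MM>" for x y
    using that val_add[of x y] by (cases "x = 0 \<or> y = 0 \<or> x + y = 0") (auto simp: val_pos_def min_def split: if_splits)
  then show ?thesis unfolding fractional_def using val_pos_mult by (auto simp: val_pos_def)
qed

lemma val_pos_subset: "\<MM> \<subseteq> \<O>"
  by (auto simp: val_pos_def val_ge_def)

lemma val_ge_subset_val_pos: "0 < g \<Longrightarrow> val_ge v g \<subseteq> \<MM>"
  by (auto simp: val_pos_def val_ge_def)

lemma one_in [simp]: "1 \<in> \<O>" and one_notin [simp]: "1 \<notin> \<MM>"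
  by (simp_all add: val_ge_def val_pos_def)

lemma unit_notin: "x \<noteq> 0 \<Longrightarrow> v x = 0 \<Longrightarrow> x \<notin> \<MM>"
  by (simp add: val_pos_def)

lemma notin_val_pos: "x \<in> \<O> \<Longrightarrow> x \<notin> \<MM> \<Longrightarrow> x \<noteq> 0 \<and> v x = 0"
  by (auto simp: val_pos_def val_ge_def)

lemma val_pos_prime: "x \<in> \<O> \<Longrightarrow> y \<in> \<O> \<Longrightarrow> x * y \<in> \<MM> \<Longrightarrow> x \<in> \<MM> \<or> y \<in> \<MM>"
  by (metis add_0_left mult_eq_0_iff notin_val_pos unit_notin val_mult)

context
  fixes I assumes I: "fractional I"
begin

lemma fractional_zero: "0 \<in> I"
  and fractional_add: "x \<in> I \<Longrightarrow> y \<in> I \<Longrightarrow> x + y \<in> I"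
  and fractional_mult: "r \<in> \<O> \<Longrightarrow> x \<in> I \<Longrightarrow> r * x \<in> I"
  using I unfolding fractional_def by blast+

lemma fractional_uminus: "x \<in> I \<Longrightarrow> - x \<in> I"
  using fractional_mult[of "- 1" x] by (simp add: val_ge_def)

lemma fractional_diff: "x \<in> I \<Longrightarrow> y \<in> I \<Longrightarrow> x - y \<in> I"
  using fractional_add[of x "- y"] fractional_uminus by simp

lemma fractional_diff_iff: "x - y \<in> I \<Longrightarrow> x \<in> I \<longleftrightarrow> y \<in> I"
  using fractional_add[of "x - y" y] fractional_diff[of x "x - y"] by auto

lemma fractional_sum: "(\<And>i. i \<in> A \<Longrightarrow> f i \<in> I) \<Longrightarrow> sum f A \<in> I"
  by (induction A rule: infinite_finite_induct) (auto simp: fractional_zero fractional_add)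

lemma coeffs_in_0: "0 \<in> coeffs_in I"
  by (simp add: coeffs_in_def fractional_zero)

lemma coeffs_in_add: "p \<in> coeffs_in I \<Longrightarrow> q \<in> coeffs_in I \<Longrightarrow> p + q \<in> coeffs_in I"
  by (simp add: coeffs_in_def fractional_add)

lemma coeffs_in_diff: "p \<in> coeffs_in I \<Longrightarrow> q \<in> coeffs_in I \<Longrightarrow> p - q \<in> coeffs_in I"
  by (simp add: coeffs_in_def fractional_diff)

lemma coeffs_in_mult: "p \<in> coeffs_in \<O> \<Longrightarrow> q \<in> coeffs_in I \<Longrightarrow> p * q \<in> coeffs_in I"
  by (auto simp: coeffs_in_def coeff_mult intro!: fractional_sum fractional_mult)

lemma coeffs_in_smult: "c \<in> \<O> \<Longrightarrow> q \<in> coeffs_in I \<Longrightarrow> smult c q \<in> coeffs_in I"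
  by (auto simp: coeffs_in_def intro!: fractional_mult)

lemma poly_in:
  assumes "p \<in> coeffs_in I" "x \<in> \<O>"
  shows "poly p x \<in> I"
proof -
  have "x ^ i \<in> \<O>" for i
  proof (induction i)
    case (Suc i)
    then show ?case using val_ge_mult[OF assms(2), of "x ^ i" 0] by simp
  qed simp
  then show ?thesis
    using assms unfolding poly_altdef coeffs_in_def
    by (auto intro!: fractional_sum simp: mult.commute[of "coeff p _"] fractional_mult)
qed

end

lemma coeffs_in_1: "1 \<in> coeffs_in \<O>"
  by (auto simp: coeffs_in_def val_ge_def coeff_1)

lemma coeffs_in_prod: "(\<And>p. p \<in> S \<Longrightarrow> f p \<in> coeffs_in \<O>) \<Longrightarrow> prod f S \<in> coeffs_in \<O>"
  by (induction S rule: infinite_finite_induct) (auto simp: coeffs_in_1 intro!: coeffs_in_mult)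

section \<open>Gauss's lemma and stable irreducibility over a valuation ring\<close>

text \<open>
Modulo the prime ideal \<open>\<MM>\<close> only one summand of the convolution survives. The indices \<open>i\<close> and \<open>j\<close> are
typically extremal among the coefficients outside \<open>\<MM>\<close>.
\<close>

lemma coeff_mult_notin_val_pos:
  assumes "A \<in> coeffs_in \<O>" "B \<in> coeffs_in \<O>" "coeff A i \<notin> \<MM>" "coeff B j \<notin> \<MM>"
    and other: "\<And>k. k \<le> i + j \<Longrightarrow> k \<noteq> i \<Longrightarrow> coeff A k \<in> \<MM> \<or> coeff B (i + j - k) \<in> \<MM>"
  shows "coeff (A * B) (i + j) \<notin> \<MM>"
proof
  assume *: "coeff (A * B) (i + j) \<in> \<MM>"
  have "coeff (A * B) (i + j) - coeff A i * coeff B j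
      = (\<Sum>k\<in>{..i + j} - {i}. coeff A k * coeff B (i + j - k))"
    by (simp add: coeff_mult sum.remove[of "{..i + j}" i])
  also have "\<dots> \<in> \<MM>"
  proof (rule fractional_sum[OF fractional_val_pos])
    fix k assume "k \<in> {..i + j} - {i}"
    then have "coeff A k \<in> \<MM> \<or> coeff B (i + j - k) \<in> \<MM>" using other by simp
    then show "coeff A k * coeff B (i + j - k) \<in> \<MM>"
      using val_pos_mult[of "coeff A k" "coeff B (i + j - k)"] assms(1,2)
        val_pos_mult[of "coeff B (i + j - k)" "coeff A k"]
      by (auto simp: coeffs_in_def mult.commute)
  qed
  finally have "coeff A i * coeff B j \<in> \<MM>"
    using * fractional_diff_iff[OF fractional_val_pos] by blast
  then show False using val_pos_prime assms(1-4) by (meson coeffs_inD)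
qed

lemma lead_coeff_mult_notin_val_pos:
  assumes "A \<in> coeffs_in \<O>" "B \<in> coeffs_in \<O>" "lead_coeff A \<notin> \<MM>" "lead_coeff B \<notin> \<MM>"
  shows "coeff (A * B) (degree A + degree B) \<notin> \<MM>"
  using val_pos_prime[of "lead_coeff A" "lead_coeff B"] assms
  by (auto simp: coeff_mult_degree_sum coeffs_in_def)

lemma least_unit_coeffs_mult:
  assumes "A \<in> coeffs_in \<O>" "B \<in> coeffs_in \<O>" "A \<notin> coeffs_in \<MM>" "B \<notin> coeffs_in \<MM>"
  obtains i j where "coeff A i \<notin> \<MM>" "coeff B j \<notin> \<MM>" "coeff (A * B) (i + j) \<notin> \<MM>"
    "\<And>k. k < i \<Longrightarrow> coeff A k \<in> \<MM>" "\<And>k. k < j \<Longrightarrow> coeff B k \<in> \<MM>"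
proof -
  have least: "\<exists>i. coeff C i \<notin> \<MM> \<and> (\<forall>k<i. coeff C k \<in> \<MM>)" if "C \<notin> coeffs_in \<MM>" for C
    using that exists_least_iff[of "\<lambda>i. coeff C i \<notin> \<MM>"] by (auto simp: coeffs_in_def)
  obtain i where i: "coeff A i \<notin> \<MM>" "\<And>k. k < i \<Longrightarrow> coeff A k \<in> \<MM>"
    using least[OF assms(3)] by blast
  obtain j where j: "coeff B j \<notin> \<MM>" "\<And>k. k < j \<Longrightarrow> coeff B k \<in> \<MM>"
    using least[OF assms(4)] by blast
  have "coeff A k \<in> \<MM> \<or> coeff B (i + j - k) \<in> \<MM>" if "k \<le> i + j" "k \<noteq> i" for k
    using that i(2)[of k] j(2)[of "i + j - k"] by linarith
  then have "coeff (A * B) (i + j) \<notin> \<MM>"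
    by (intro coeff_mult_notin_val_pos assms i j)
  then show ?thesis using that i j by blast
qed

lemma primitive_mult:
  assumes "A \<in> coeffs_in \<O>" "B \<in> coeffs_in \<O>" "A \<notin> coeffs_in \<MM>" "B \<notin> coeffs_in \<MM>"
  shows "A * B \<notin> coeffs_in \<MM>"
  using least_unit_coeffs_mult[OF assms] coeffs_inD[of "A * B" \<MM>] by metis

lemma primitive_multiple_exists:
  assumes "A \<noteq> 0"
  shows "\<exists>\<alpha>. \<alpha> \<noteq> 0 \<and> smult \<alpha> A \<in> coeffs_in \<O> \<and> smult \<alpha> A \<notin> coeffs_in \<MM>"
proof -
  let ?S = "{i. i \<le> degree A \<and> coeff A i \<noteq> 0}"
  have "finite ?S" "?S \<noteq> {}" using assms by (auto intro!: exI[of _ "degree A"])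
  then obtain i where i: "i \<in> ?S" "\<And>j. j \<in> ?S \<Longrightarrow> v (coeff A i) \<le> v (coeff A j)"
    using ex_is_arg_min_if_finite[of ?S "\<lambda>i. v (coeff A i)"] by (auto simp: is_arg_min_def not_less)
  let ?\<alpha> = "inverse (coeff A i)"
  have "?\<alpha> * coeff A j \<in> \<O>" for j
  proof (cases "coeff A j = 0")
    case False
    then have "j \<in> ?S" using le_degree by auto
    then show ?thesis using False i val_mult[of ?\<alpha> "coeff A j"] val_inverse[of "coeff A i"]
      by (auto simp: val_ge_def)
  qed (simp add: val_ge_def)
  moreover have "?\<alpha> * coeff A i \<notin> \<MM>" using i(1) by simp
  ultimately have "smult ?\<alpha> A \<in> coeffs_in \<O>" "smult ?\<alpha> A \<notin> coeffs_in \<MM>"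
    using coeffs_inD[of "smult ?\<alpha> A" \<MM> i] by (auto simp: coeffs_in_def)
  then show ?thesis using i(1) by (intro exI[of _ ?\<alpha>]) auto
qed

text \<open>
Gauss's lemma. After scaling both factors to be primitive, their product is primitive too, and
it is a multiple of the integral polynomial \<open>A * B\<close>; so the product of the scalars cannot have
positive value, and one of the scalars can be replaced by the inverse of the other.
\<close>

lemma gauss_factors_integral:
  assumes "A * B \<in> coeffs_in \<O>" "lead_coeff (A * B) \<notin> \<MM>" 
  obtains \<alpha> where "\<alpha> \<noteq> 0" "smult \<alpha> A \<in> coeffs_in \<O>" "smult (inverse \<alpha>) B \<in> coeffs_in \<O>"
proof -
  have nz: "A \<noteq> 0" "B \<noteq> 0" using assms(2) by (auto simp: val_pos_def)
  obtain \<alpha> where \<alpha>: "\<alpha> \<noteq> 0" "smult \<alpha> A \<in> coeffs_in \<O>" "smult \<alpha> A \<notin> coeffs_in \<MM>"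
    using primitive_multiple_exists[OF nz(1)] by blast
  obtain \<beta> where \<beta>: "\<beta> \<noteq> 0" "smult \<beta> B \<in> coeffs_in \<O>" "smult \<beta> B \<notin> coeffs_in \<MM>"
    using primitive_multiple_exists[OF nz(2)] by blast
  have "smult (\<alpha> * \<beta>) (A * B) \<notin> coeffs_in \<MM>"
    using primitive_mult[OF \<alpha>(2) \<beta>(2) \<alpha>(3) \<beta>(3)] by (simp add: mult.commute)
  then have "\<alpha> * \<beta> \<notin> \<MM>"
    using val_pos_mult[of "coeff (A * B) _" "\<alpha> * \<beta>"] assms(1)
    by (auto simp: coeffs_in_def mult.commute[of "\<alpha> * \<beta>"])
  then have "v (\<alpha> * \<beta>) \<le> 0" by (auto simp: val_pos_def)
  then have "inverse (\<alpha> * \<beta>) \<in> \<O>" using val_inverse[of "\<alpha> * \<beta>"] \<alpha> \<beta> by (simp add: val_ge_def)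
  then have "smult (inverse (\<alpha> * \<beta>)) (smult \<beta> B) \<in> coeffs_in \<O>"
    using \<beta>(2) by (rule coeffs_in_smult[OF fractional_val_ge])
  then have "smult (inverse \<alpha>) B \<in> coeffs_in \<O>" using \<beta>(1) by (simp add: mult.assoc)
  then show ?thesis using that \<alpha> by blast
qed

text \<open>
Irreducibility over the valuation ring that is still visible when coefficients are only known up
to \<open>val_ge v g\<close>. Leading coefficients outside \<open>\<MM>\<close> prevent the degree of a factor from
dropping modulo \<open>\<MM>\<close>.
\<close>

definition stably_irreducible :: "'a poly \<Rightarrow> 'g \<Rightarrow> bool" where
  "stably_irreducible P g \<longleftrightarrow>
     P \<in> coeffs_in \<O> \<and> lead_coeff P \<notin> \<MM> \<and> 0 < degree P \<and> 0 < g \<and>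
     (\<forall>A\<in>coeffs_in \<O>. \<forall>B\<in>coeffs_in \<O>. lead_coeff A \<notin> \<MM> \<longrightarrow> lead_coeff B \<notin> \<MM> \<longrightarrow>
        A * B - P \<in> coeffs_in (val_ge v g) \<longrightarrow> degree A = 0 \<or> degree B = 0)"

lemma coeffs_in_mono: "S \<subseteq> T \<Longrightarrow> coeffs_in S \<subseteq> coeffs_in T"
  by (auto simp: coeffs_in_def)

text \<open>
A factorization of \<open>f\<close> over the field can be moved into the valuation ring by Gauss's lemma, and
there it is a factorization of \<open>P\<close> up to \<open>val_ge v g\<close>.
\<close>

lemma stably_irreducible_imp_irreducible:
  assumes P: "stably_irreducible P g" and f: "f - P \<in> coeffs_in (val_ge v g)" "degree f = degree P"
  shows "Factorial_Ring.irreducible f"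
proof -
  have g: "0 < g" "0 < degree P" and PO: "P \<in> coeffs_in \<O>" and lP: "lead_coeff P \<notin> \<MM>"
    using P by (auto simp: stably_irreducible_def)
  have fM: "f - P \<in> coeffs_in \<MM>"
    using f(1) coeffs_in_mono[OF val_ge_subset_val_pos[OF g(1)]] by blast
  then have "f - P \<in> coeffs_in \<O>" using coeffs_in_mono[OF val_pos_subset] by blast
  then have fO: "f \<in> coeffs_in \<O>" using coeffs_in_add[OF _ _ PO, of "f - P"] by simp
  have "lead_coeff f - lead_coeff P \<in> \<MM>" using coeffs_inD[OF fM, of "degree f"] f(2) by simp
  then have lf: "lead_coeff f \<notin> \<MM>" using lP fractional_diff_iff[OF fractional_val_pos] by blast
  show ?thesis
  proof (rule Factorial_Ring.irreducibleI)
    show "f \<noteq> 0" using f(2) g(2) by auto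
    then show "\<not> f dvd 1" using f(2) g(2) by (simp add: is_unit_iff_degree)
    fix A B assume AB: "f = A * B"
    obtain \<alpha> where \<alpha>: "\<alpha> \<noteq> 0" "smult \<alpha> A \<in> coeffs_in \<O>" "smult (inverse \<alpha>) B \<in> coeffs_in \<O>"
      using gauss_factors_integral[of A B] fO lf AB by blast
    let ?A = "smult \<alpha> A" and ?B = "smult (inverse \<alpha>) B"
    have f': "f = ?A * ?B" using AB \<alpha>(1) by simp
    have "lead_coeff ?A * lead_coeff ?B \<notin> \<MM>" using lf unfolding f' lead_coeff_mult .
    then have "lead_coeff ?A \<notin> \<MM>" "lead_coeff ?B \<notin> \<MM>"
      using val_pos_mult[of "lead_coeff ?A" "lead_coeff ?B"] val_pos_mult[of "lead_coeff ?B" "lead_coeff ?A"]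
        coeffs_inD[OF \<alpha>(2)] coeffs_inD[OF \<alpha>(3)] by (auto simp: mult.commute)
    then have "degree ?A = 0 \<or> degree ?B = 0"
      using P \<alpha> f(1) f' unfolding stably_irreducible_def by metis
    then have "degree A = 0 \<or> degree B = 0" using \<alpha>(1) by simp
    moreover have "A \<noteq> 0" "B \<noteq> 0" using AB f(2) g(2) by auto
    ultimately show "A dvd 1 \<or> B dvd 1" by (simp add: is_unit_iff_degree)
  qed
qed

lemma coeff_degree_sum_cong_notin_val_pos:
  assumes "P \<in> coeffs_in \<O>" "A \<in> coeffs_in \<O>" "B \<in> coeffs_in \<O>" 
    "lead_coeff A \<notin> \<MM>" "lead_coeff B \<notin> \<MM>" "A * B - P \<in> coeffs_in \<MM>"
  shows "coeff P (degree A + degree B) \<notin> \<MM>"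
  using lead_coeff_mult_notin_val_pos[OF assms(2-5)] coeffs_inD[OF assms(6), of "degree A + degree B"]
    fractional_diff_iff[OF fractional_val_pos] by (metis coeff_diff)

text \<open>
Eisenstein's criterion: modulo \<open>\<MM>\<close> both factors would be powers of \<open>X\<close> up to units, so their
constant terms would be multiples of \<open>t\<close> and \<open>t\<close> itself would be one of \<open>t^2\<close>. Only coefficients
modulo \<open>t^2\<close> enter the argument, whence the precision \<open>v t + v t\<close>.
\<close>

lemma stably_irreducible_eisenstein:
  assumes t: "t \<noteq> 0" "\<MM> = {y * t |y. y \<in> \<O>}" and N: "0 < N"
  shows "stably_irreducible (monom 1 N + [:t:]) (v t + v t)"
proof -
  let ?P = "monom 1 N + [:t:]"
  have tM: "t \<in> \<MM>" using t(2) by force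
  then have vt: "0 < v t" using t(1) by (simp add: val_pos_def)
  have coeff_P: "coeff ?P i = (if i = N then 1 else if i = 0 then t else 0)" for i
    using N by (auto simp: coeff_pCons split: nat.splits)
  have deg: "degree ?P = N"
    using N by (simp add: degree_add_eq_left degree_monom_eq)
  have PO: "?P \<in> coeffs_in \<O>" 
    using tM val_pos_subset unfolding coeffs_in_def mem_Collect_eq coeff_P
    by (auto simp: fractional_zero)
  have "degree A = 0 \<or> degree B = 0" if A: "A \<in> coeffs_in \<O>" "lead_coeff A \<notin> \<MM>"
    and B: "B \<in> coeffs_in \<O>" "lead_coeff B \<notin> \<MM>" and AB: "A * B - ?P \<in> coeffs_in (val_ge v (v t + v t))" for A B
  proof (rule ccontr)
    assume contra: "\<not> ?thesis"
    have "0 < v t + v t" using vt by (simp add: add_pos_pos)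
    then have ABM: "A * B - ?P \<in> coeffs_in \<MM>"
      using AB coeffs_in_mono[OF val_ge_subset_val_pos] by blast
    have PM: "coeff ?P i \<in> \<MM> \<longleftrightarrow> i \<noteq> N" for i
      unfolding coeff_P using tM by (auto simp: fractional_zero)
    have N_eq: "degree A + degree B = N"
      using coeff_degree_sum_cong_notin_val_pos[OF PO A(1) B(1) A(2) B(2) ABM] unfolding PM by simp
    obtain i j where ij: "coeff A i \<notin> \<MM>" "coeff B j \<notin> \<MM>" "coeff (A * B) (i + j) \<notin> \<MM>"
      and ltA: "\<And>k. k < i \<Longrightarrow> coeff A k \<in> \<MM>" and ltB: "\<And>k. k < j \<Longrightarrow> coeff B k \<in> \<MM>"
      using least_unit_coeffs_mult[OF A(1) B(1)] coeffs_inD[of A] coeffs_inD[of B] A(2) B(2) by metis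
    have le: "i \<le> degree A" "j \<le> degree B"
      using ltA[of "degree A"] ltB[of "degree B"] A(2) B(2) by (meson not_le)+
    have "coeff ?P (i + j) \<notin> \<MM>"
      using ij(3) coeffs_inD[OF ABM, of "i + j"] fractional_diff_iff[OF fractional_val_pos] by (metis coeff_diff)
    then have "i + j = N" unfolding PM by simp
    then have "i = degree A" "j = degree B" using le N_eq by auto
    then have "coeff A 0 \<in> \<MM>" "coeff B 0 \<in> \<MM>" using contra ltA ltB by auto
    moreover have "y * t \<in> val_ge v (v t)" if "y \<in> \<O>" for y
      using val_ge_mult[OF that, of t "v t"] by (simp add: val_ge_def)
    ultimately have "coeff A 0 \<in> val_ge v (v t)" "coeff B 0 \<in> val_ge v (v t)"
      unfolding t(2) by auto
    then have "coeff A 0 * coeff B 0 \<in> val_ge v (v t + v t)" by (rule val_ge_mult)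
    moreover have "coeff A 0 * coeff B 0 - t \<in> val_ge v (v t + v t)"
      using coeffs_inD[OF AB, of 0] unfolding coeff_diff coeff_P using N by (simp add: coeff_mult_0)
    ultimately have "t \<in> val_ge v (v t + v t)"
      using fractional_diff_iff[OF fractional_val_ge] by blast
    then show False using t(1) vt by (auto simp: val_ge_def)
  qed
  then show ?thesis
    unfolding stably_irreducible_def deg using PO N vt coeff_P[of N] by (auto simp: add_pos_pos)
qed

lemma finite_polys_bounded_degree:
  assumes "finite S"
  shows "finite {p. degree p \<le> n \<and> p \<in> coeffs_in S}"
proof (rule finite_subset)
  show "finite (Poly ` {xs. set xs \<subseteq> S \<and> length xs \<le> Suc n})"
    using finite_lists_length_le[OF assms] by blast
  show "{p. degree p \<le> n \<and> p \<in> coeffs_in S} \<subseteq> Poly ` {xs. set xs \<subseteq> S \<and> length xs \<le> Suc n}"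
  proof
    fix p assume p: "p \<in> {p. degree p \<le> n \<and> p \<in> coeffs_in S}"
    have "length (coeffs p) \<le> Suc n" using p by (cases "p = 0") (auto simp: length_coeffs_degree)
    moreover have "set (coeffs p) \<subseteq> S"
      using p by (auto simp: coeffs_in_def coeffs_def)
    ultimately show "p \<in> Poly ` {xs. set xs \<subseteq> S \<and> length xs \<le> Suc n}"
      by (intro image_eqI[of _ _ "coeffs p"]) auto
  qed
qed

text \<open>
Euclid's proof that there are infinitely many primes, for polynomials over the finite residue
field. Congruences modulo \<open>\<MM>\<close> between polynomials over the valuation ring replace polynomials over
the quotient ring. A divisor \<open>P\<close> of positive minimal degree of \<open>1 + X * Prod\<close>, where \<open>Prod\<close> is
the product of representatives of all nonconstant residue polynomials of degree at most \<open>D\<close>, is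
irreducible modulo \<open>\<MM>\<close> and cannot itself have degree at most \<open>D\<close>.
\<close>

lemma stably_irreducible_euclid:
  assumes R: "finite R" "\<And>x. x \<in> \<O> \<Longrightarrow> \<exists>r\<in>R. x - r \<in> \<MM>" and g: "0 < g"
  shows "\<exists>P. D < degree P \<and> stably_irreducible P g"
proof -
  \<comment> \<open>Sending \<open>0\<close> to \<open>0\<close> keeps the degree from growing when representatives replace coefficients.\<close>
  define \<rho> where "\<rho> x = (if x = 0 then 0 else SOME r. r \<in> R \<and> x - r \<in> \<MM>)" for x
  have \<rho>: "x - \<rho> x \<in> \<MM>" "\<rho> x \<in> insert 0 R" if "x \<in> \<O>" for x
    using someI_ex[of "\<lambda>r. r \<in> R \<and> x - r \<in> \<MM>"] R(2)[OF that]
    by (auto simp: \<rho>_def fractional_zero)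
  define S where "S = {p. degree p \<le> D \<and> p \<in> coeffs_in (insert 0 R)} \<inter>
    {p. p \<in> coeffs_in \<O> \<and> 0 < degree p \<and> lead_coeff p \<notin> \<MM>}"
  have finS: "finite S" unfolding S_def using finite_polys_bounded_degree R(1) by blast
  define Q where "Q = 1 + pCons 0 (\<Prod>p\<in>S. p)"
  have prodO: "(\<Prod>p\<in>T. p) \<in> coeffs_in \<O>" if "T \<subseteq> S" for T
    using that by (intro coeffs_in_prod) (auto simp: S_def)
  have X: "pCons 0 1 \<in> coeffs_in \<O>"
    by (auto simp: coeffs_in_def coeff_pCons fractional_zero split: nat.splits)
  have pC: "pCons 0 p = pCons 0 1 * p" for p :: "'a poly" by (simp add: one_pCons)
  have pCO: "pCons 0 p \<in> coeffs_in \<O>" if "p \<in> coeffs_in \<O>" for p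
    unfolding pC[of p] using X that by (intro coeffs_in_mult) auto
  have QO: "Q \<in> coeffs_in \<O>" unfolding Q_def
    by (intro coeffs_in_add coeffs_in_1 pCO prodO) auto
  have lead_prod: "lead_coeff (\<Prod>p\<in>T. p) \<notin> \<MM>" if "finite T" "T \<subseteq> S" for T
    using that
  proof (induction T)
    case (insert p T)
    then show ?case using val_pos_prime[of "lead_coeff p" "lead_coeff (\<Prod>p\<in>T. p)"] 
      prodO[of T] by (auto simp: lead_coeff_mult S_def coeffs_in_def)
  qed simp
  have nz: "(\<Prod>p\<in>S. p) \<noteq> 0" using lead_prod[OF finS] by (auto simp: val_pos_def)
  have degQ: "degree Q = Suc (degree (\<Prod>p\<in>S. p))"
    unfolding Q_def using nz by (subst degree_add_eq_right) auto
  have lQ: "lead_coeff Q \<notin> \<MM>"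
    using lead_prod[OF finS] unfolding degQ by (simp add: Q_def)
  define residual_dvd where "residual_dvd P \<longleftrightarrow> P \<in> coeffs_in \<O> \<and> lead_coeff P \<notin> \<MM> \<and> 0 < degree P \<and>
     (\<exists>B\<in>coeffs_in \<O>. P * B - Q \<in> coeffs_in \<MM>)" for P
  have "residual_dvd Q" unfolding residual_dvd_def using QO lQ degQ coeffs_in_1
    by (auto intro!: bexI[of _ 1] coeffs_in_0)
  then obtain P where P: "residual_dvd P" and min: "\<And>P'. residual_dvd P' \<Longrightarrow> degree P \<le> degree P'"
    using ex_has_least_nat[of residual_dvd _ degree] by blast
  then obtain B where PO: "P \<in> coeffs_in \<O>" and lP: "lead_coeff P \<notin> \<MM>" and dP: "0 < degree P"
    and B: "B \<in> coeffs_in \<O>" "P * B - Q \<in> coeffs_in \<MM>"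
    unfolding residual_dvd_def by blast
  have split: "degree A = 0 \<or> degree C = 0" if A: "A \<in> coeffs_in \<O>" "lead_coeff A \<notin> \<MM>"
    and C: "C \<in> coeffs_in \<O>" "lead_coeff C \<notin> \<MM>" and AC: "A * C - P \<in> coeffs_in (val_ge v g)" for A C
  proof (rule ccontr)
    assume contra: "\<not> ?thesis"
    have ACM: "A * C - P \<in> coeffs_in \<MM>"
      using AC coeffs_in_mono[OF val_ge_subset_val_pos[OF g]] by blast
    have "coeff P (degree A + degree C) \<notin> \<MM>"
      by (rule coeff_degree_sum_cong_notin_val_pos[OF PO A(1) C(1) A(2) C(2) ACM])
    then have "coeff P (degree A + degree C) \<noteq> 0" by (auto simp: fractional_zero)
    then have "degree A + degree C \<le> degree P" by (rule le_degree)
    moreover have "B * (A * C - P) + (P * B - Q) \<in> coeffs_in \<MM>"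
      using ACM B by (intro coeffs_in_add coeffs_in_mult) auto
    then have "A * (C * B) - Q \<in> coeffs_in \<MM>" by (simp add: algebra_simps)
    then have "residual_dvd A" unfolding residual_dvd_def using A contra coeffs_in_mult[OF _ C(1) B(1)] by auto
    then have "degree P \<le> degree A" by (rule min)
    ultimately show False using contra by simp
  qed
  have "stably_irreducible P g"
    unfolding stably_irreducible_def by (intro conjI ballI impI PO lP dP g split)
  moreover have "D < degree P"
  proof (rule ccontr)
    assume "\<not> D < degree P"
    define P' where "P' = map_poly \<rho> P"
    have co: "coeff P' i = \<rho> (coeff P i)" for i
      unfolding P'_def by (simp add: coeff_map_poly \<rho>_def)
    have PP': "P - P' \<in> coeffs_in \<MM>"
      using \<rho>(1) PO by (auto simp: coeffs_in_def co)
    have P'O: "P' \<in> coeffs_in \<O>"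
      using coeffs_in_diff[OF _ PO, of "P - P'"] PP' coeffs_in_mono[OF val_pos_subset] by auto
    have "coeff P' (degree P) \<notin> \<MM>"
      using coeffs_inD[OF PP', of "degree P"] lP fractional_diff_iff[OF fractional_val_pos]
      by (metis coeff_diff)
    moreover from this have "degree P' = degree P"
      by (intro antisym le_degree degree_le) (auto simp: co coeff_eq_0 \<rho>_def val_pos_def)
    ultimately have "P' \<in> S"
      using \<open>\<not> D < degree P\<close> \<rho>(2) PO dP P'O unfolding S_def by (auto simp: coeffs_in_def co)
    then have prod: "(\<Prod>p\<in>S. p) = P' * (\<Prod>p\<in>S - {P'}. p)"
      using finS by (simp add: prod.remove)
    define Y where "Y = pCons 0 (\<Prod>p\<in>S - {P'}. p)"
    have YO: "Y \<in> coeffs_in \<O>" unfolding Y_def by (intro pCO prodO) auto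
    have Q: "Q = 1 + P' * Y" unfolding Q_def Y_def prod by simp
    \<comment> \<open>Now \<open>P\<close> divides both \<open>Q\<close> and \<open>Q - 1\<close> modulo \<open>\<MM>\<close>, so it is invertible there with inverse \<open>Z\<close>,
  which is impossible for a polynomial of positive degree.\<close>
  define Z where "Z = B - Y"
    have ZO: "Z \<in> coeffs_in \<O>" unfolding Z_def using B YO by (intro coeffs_in_diff) auto
    have "(P * B - Q) - Y * (P - P') \<in> coeffs_in \<MM>"
      by (intro coeffs_in_diff[OF fractional_val_pos B(2)] coeffs_in_mult[OF fractional_val_pos] YO PP')
    then have PZ: "P * Z - 1 \<in> coeffs_in \<MM>" unfolding Q Z_def by (simp add: algebra_simps)
    show False
    proof (cases "Z \<in> coeffs_in \<MM>")
      case True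
      then have "P * Z \<in> coeffs_in \<MM>" using PO by (intro coeffs_in_mult) auto
      then have "P * Z - (P * Z - 1) \<in> coeffs_in \<MM>"
        using PZ by (rule coeffs_in_diff[OF fractional_val_pos])
      then have "1 \<in> coeffs_in \<MM>" by simp
      from coeffs_inD[OF this, of 0] show False by simp
    next
      case False
      then obtain z0 where z0: "coeff Z z0 \<notin> \<MM>" by (auto simp: coeffs_in_def)
      \<comment> \<open>The top coefficient of \<open>P * Z\<close> outside \<open>\<MM>\<close> has positive index and so cannot belong to \<open>1\<close>.\<close>
      define z where "z = (GREATEST z. coeff Z z \<notin> \<MM>)"
      have bound: "z \<le> degree Z" if "coeff Z z \<notin> \<MM>" for z
        using that le_degree[of Z z] by (auto simp: val_pos_def)
      have z: "coeff Z z \<notin> \<MM>"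
        unfolding z_def using GreatestI_nat[of "\<lambda>z. coeff Z z \<notin> \<MM>", OF z0] bound by blast
      have zmax: "coeff Z k \<in> \<MM>" if "k > z" for k
        using Greatest_le_nat[of "\<lambda>z. coeff Z z \<notin> \<MM>" k "degree Z"] bound that
        unfolding z_def by (meson not_le)
      have "coeff P k \<in> \<MM> \<or> coeff Z (degree P + z - k) \<in> \<MM>" if "k \<noteq> degree P" for k
        using that zmax by (cases "k < degree P") (auto simp: coeff_eq_0 fractional_zero)
      then have "coeff (P * Z) (degree P + z) \<notin> \<MM>"
        by (intro coeff_mult_notin_val_pos PO ZO lP z)
      moreover have "coeff (P * Z - 1) (degree P + z) = coeff (P * Z) (degree P + z)"
        using dP by simp
      ultimately show False using coeffs_inD[OF PZ, of "degree P + z"] by metis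
    qed
  qed
  ultimately show ?thesis by blast
qed

end

section \<open>Residue fields and the supply of stably irreducible polynomials\<close>

lemma val_pos_eq_maximal_ideal:
  "valuation v \<Longrightarrow> maximalideal M (ring_on (valuation_ring v)) \<Longrightarrow> M = val_pos v"
  using maximalideal_valuation_ring_iff[of v M] by (auto simp: val_pos_def)

context valued_field
begin

lemma principal_maximal_ideal_generator:
  assumes "principalideal \<MM> (ring_on \<O>)" "\<MM> \<noteq> {0}"
  obtains t where "t \<noteq> 0" "\<MM> = {y * t |y. y \<in> \<O>}"
proof -
  interpret domain "ring_on \<O>"
    using domain_ring_on[OF subring_valuation_ring[OF valuation]] by (simp add: valuation_ring_eq)
  obtain t where t: "t \<in> \<O>" "\<MM> = PIdl\<^bsub>ring_on \<O>\<^esub> t"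
    using principalideal.generate[OF assms(1)] cgenideal_eq_genideal by auto
  then have M: "\<MM> = {y * t |y. y \<in> \<O>}" unfolding cgenideal_def by simp
  have "t \<noteq> 0"
  proof
    assume "t = 0"
    then have "\<MM> \<subseteq> {0}" unfolding M by auto
    then show False using assms(2) fractional_zero[OF fractional_val_pos] by blast
  qed
  then show ?thesis using that M by blast
qed

lemma finite_residue_representatives:
  assumes "maximalideal \<MM> (ring_on \<O>)" "finite (carrier (ring_on \<O> Quot \<MM>))"
  obtains R where "finite R" "\<And>x. x \<in> \<O> \<Longrightarrow> \<exists>r\<in>R. x - r \<in> \<MM>"
proof
  let ?C = "\<lambda>x. (\<lambda>m. m + x) ` \<MM>"
  have carrier: "carrier (ring_on \<O> Quot \<MM>) = ?C ` \<O>"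
    unfolding FactRing_def A_RCOSETS_def' a_r_coset_def' by auto
  show "finite ((\<lambda>C. SOME r. r \<in> C) ` (?C ` \<O>))" using assms(2) carrier by simp
  fix x assume x: "x \<in> \<O>"
  have "x \<in> ?C x" using fractional_zero[OF fractional_val_pos] by force
  then have "(SOME r. r \<in> ?C x) \<in> ?C x" by (rule someI)
  then obtain m where "m \<in> \<MM>" "(SOME r. r \<in> ?C x) = m + x" by blast
  then have "x - (SOME r. r \<in> ?C x) \<in> \<MM>"
    using fractional_uminus[OF fractional_val_pos, of m] by simp
  then show "\<exists>r\<in>(\<lambda>C. SOME r. r \<in> C) ` (?C ` \<O>). x - r \<in> \<MM>" using x by blast
qed

text \<open>
Otherwise the valuation ring is the whole field, \<open>\<MM>\<close> is zero, and the residue field is the infinite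
field itself.
\<close>

lemma exists_positive_value:
  assumes infinite: "infinite (UNIV :: 'a set)" and max: "maximalideal \<MM> (ring_on \<O>)"
    and M: "(\<MM> \<noteq> {0} \<and> principalideal \<MM> (ring_on \<O>)) \<or> finite (carrier (ring_on \<O> Quot \<MM>))"
  shows "\<exists>x. x \<noteq> 0 \<and> 0 < v x"
proof (rule ccontr)
  assume *: "\<not> ?thesis"
  then have zero: "\<MM> = {0}" by (auto simp: val_pos_def)
  then have "finite (carrier (ring_on \<O> Quot \<MM>))" using M by blast
  then obtain R where R: "finite R" "\<And>x. x \<in> \<O> \<Longrightarrow> \<exists>r\<in>R. x - r \<in> \<MM>"
    using finite_residue_representatives[OF max] by blast
  have "0 \<le> v x" if "x \<noteq> 0" for x
    using * that val_inverse[of x] by (metis inverse_nonzero_iff_nonzero neg_0_less_iff_less not_le)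
  then have "x \<in> \<O>" for x by (auto simp: val_ge_def)
  then have "(UNIV :: 'a set) \<subseteq> R" using R(2) zero by auto
  then show False using R(1) infinite finite_subset by blast
qed

lemma stably_irreducible_exists:
  assumes infinite: "infinite (UNIV :: 'a set)" and max: "maximalideal \<MM> (ring_on \<O>)"
    and M: "(\<MM> \<noteq> {0} \<and> principalideal \<MM> (ring_on \<O>)) \<or> finite (carrier (ring_on \<O> Quot \<MM>))"
  shows "\<exists>P c. D < degree P \<and> c \<noteq> 0 \<and> stably_irreducible P (v c)"
  using M
proof
  assume "\<MM> \<noteq> {0} \<and> principalideal \<MM> (ring_on \<O>)"
  then obtain t where t: "t \<noteq> 0" "\<MM> = {y * t |y. y \<in> \<O>}"
    using principal_maximal_ideal_generator by blast
  let ?P = "Polynomial.monom 1 (Suc D) + [:t:]"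
  have "D < degree ?P" by (simp add: degree_add_eq_left degree_monom_eq)
  moreover have "stably_irreducible ?P (v (t * t))"
    using stably_irreducible_eisenstein[OF t, of "Suc D"] t(1) by (simp add: val_mult)
  ultimately show ?thesis using t(1) by (intro exI[of _ ?P] exI[of _ "t * t"]) auto
next
  assume "finite (carrier (ring_on \<O> Quot \<MM>))"
  then obtain R where R: "finite R" "\<And>x. x \<in> \<O> \<Longrightarrow> \<exists>r\<in>R. x - r \<in> \<MM>"
    using finite_residue_representatives[OF max] by blast
  obtain t where "t \<noteq> 0" "0 < v t" using exists_positive_value[OF infinite max M] by blast
  then show ?thesis using stably_irreducible_euclid[OF R, of "v t" D] by blast
qed

end

section \<open>Approximation at two independent valuations\<close>

locale two_valuations = V: valued_field v + W: valued_field w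
  for v :: "'a::Fields.field \<Rightarrow> int" and w :: "'a \<Rightarrow> 'g::linordered_ab_group_add" +
  assumes independent: "independent_valuation_rings (val_ge v 0) (val_ge w 0)"
    and nontrivial_v: "\<exists>x. x \<noteq> 0 \<and> v x \<noteq> 0"
    and nontrivial_w: "\<exists>x. x \<noteq> 0 \<and> 0 < w x"
begin

text \<open>
Otherwise the ring of \<open>w\<close> lies in the ring of \<open>v\<close>, and the two of them do not generate the field.
\<close>

lemma exists_w_integral_v_negative: "\<exists>y. y \<noteq> 0 \<and> 0 \<le> w y \<and> v y < 0"
proof (rule ccontr)
  assume "\<not> ?thesis"
  then have sub: "val_ge w 0 \<subseteq> val_ge v 0" by (force simp: val_ge_def)
  have "subring (val_ge v 0) (ring_on UNIV)"
    using subring_valuation_ring[OF V.valuation] by (simp add: V.valuation_ring_eq)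
  moreover have "ring (ring_on (UNIV :: 'a set))"
    unfolding ring_on_UNIV by (rule ring_from_type_algebra)
  ultimately have "generate_ring (ring_on UNIV) (val_ge v 0 \<union> val_ge w 0) \<subseteq> val_ge v 0"
    using sub by (intro ring.generate_ring_min_subring1) auto
  then have "x \<in> val_ge v 0" for x using independent unfolding independent_valuation_rings_def by auto
  then have ge: "0 \<le> v x" if "x \<noteq> 0" for x using that by (auto simp: val_ge_def)
  obtain x where "x \<noteq> 0" "v x \<noteq> 0" using nontrivial_v by blast
  then show False using ge[of x] ge[of "inverse x"] V.val_inverse[of x] by simp
qed

text \<open>
If \<open>v d\<close> is very negative and \<open>w d\<close> is large and positive, then \<open>d / (1 + d)\<close> is close to \<open>1\<close> for \<open>v\<close>
and close to \<open>0\<close> for \<open>w\<close>. Such a \<open>d\<close> is \<open>b * y ^ n\<close>, where \<open>b\<close> provides the positive value at \<open>w\<close> and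
\<open>y\<close> is integral for \<open>w\<close> but not for \<open>v\<close>.
\<close>

lemma separating_element:
  assumes "c \<noteq> 0"
  shows "\<exists>e. 1 - e \<in> val_ge v N \<and> e \<in> val_ge w (w c)"
proof -
  obtain t where t: "t \<noteq> 0" "0 < w t" using nontrivial_w by blast
  \<comment> \<open>The positive value of \<open>b\<close> guarantees \<open>w d > 0\<close> even if \<open>w c \<le> 0\<close>.\<close>
  define b where "b = (if 0 < w c then c else t)"
  have b: "b \<noteq> 0" "0 < w b" "w c \<le> w b" using t assms by (auto simp: b_def)
  obtain y where y: "y \<noteq> 0" "0 \<le> w y" "v y < 0" using exists_w_integral_v_negative by blast
  have vpow: "v (y ^ n) = int n * v y" for n
    by (induction n) (use y in \<open>auto simp: V.val_mult algebra_simps\<close>)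
  have wpow: "0 \<le> w (y ^ n)" for n
    by (induction n) (use y in \<open>auto simp: W.val_mult\<close>)
  define n where "n = nat (max 1 N + \<bar>v b\<bar>)"
  define d where "d = b * y ^ n"
  have d0: "d \<noteq> 0" using b y by (simp add: d_def)
  have "int n * v y \<le> - int n" using y(3) mult_left_mono[of "v y" "- 1" "int n"] by simp
  then have vd: "v d \<le> - max 1 N"
    using b y by (simp add: d_def V.val_mult vpow n_def)
  have wd: "w b \<le> w d" using b y wpow[of n] by (simp add: d_def W.val_mult)
  have d1: "1 + d \<noteq> 0"
  proof
    assume "1 + d = 0"
    then have "d = - 1" by (simp add: add_eq_0_iff)
    then show False using vd by simp
  qed
  have v1d: "v (1 + d) = v d"
  proof -
    have "v d \<le> v (1 + d)" using V.val_add[of 1 d] d0 d1 vd by simp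
    moreover have "min (v (1 + d)) 0 \<le> v d" using V.val_add[of "1 + d" "- 1"] d0 d1 by simp
    ultimately show ?thesis using vd by linarith
  qed
  have w1d: "w (1 + d) = 0"
  proof -
    have pos: "0 < w d" using wd b(2) by simp
    have "0 \<le> w (1 + d)" using W.val_add[of 1 d] d0 d1 pos by simp
    moreover have "min (w (1 + d)) (w d) \<le> 0" using W.val_add[of "1 + d" "- d"] d0 d1 by simp
    ultimately show ?thesis using pos by (auto simp: min_def split: if_splits)
  qed
  let ?e = "d / (1 + d)"
  have "1 - ?e = inverse (1 + d)" using d1 by (simp add: field_simps)
  then have "1 - ?e \<in> val_ge v N" using d1 v1d vd V.val_inverse[of "1 + d"] by (simp add: val_ge_def)
  moreover have "w ?e = w d"
    using d0 d1 w1d W.val_mult[of d "inverse (1 + d)"] W.val_inverse[of "1 + d"] by (simp add: field_simps)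
  then have "?e \<in> val_ge w (w c)" using order.trans[OF b(3) wd] by (simp add: val_ge_def)
  ultimately show ?thesis by blast
qed

lemma approximation:
  assumes "c \<noteq> 0"
  shows "\<exists>x. x - a \<in> val_ge v N \<and> x - b \<in> val_ge w (w c)"
proof (cases "a = b")
  case True
  then show ?thesis by (intro exI[of _ a]) (simp add: val_ge_def)
next
  case False
  obtain e where e: "1 - e \<in> val_ge v (N - v (b - a))" "e \<in> val_ge w (w (c / (a - b)))"
    using separating_element[of "c / (a - b)" "N - v (b - a)"] False assms by auto
  have "w c = w (a - b) + w (c / (a - b))"
    using False assms W.val_mult[of "a - b" "c / (a - b)"] by simp
  then have "(a - b) * e \<in> val_ge w (w c)"
    using W.val_ge_mult[of "a - b" "w (a - b)", OF _ e(2)] by (simp add: val_ge_def)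
  moreover have "(b - a) * (1 - e) \<in> val_ge v N"
    using V.val_ge_mult[of "b - a" "v (b - a)", OF _ e(1)] by (simp add: val_ge_def)
  ultimately show ?thesis
    by (intro exI[of _ "a * e + b * (1 - e)"]) (simp add: algebra_simps)
qed

text \<open>
The coefficients of \<open>F\<close> beyond its degree are approximated as zeros at \<open>v\<close>, while \<open>w\<close> sees \<open>P\<close>; in
particular the leading coefficient is small for \<open>v\<close> and a unit for \<open>w\<close>.
\<close>

lemma irreducible_approximation:
  assumes P: "W.stably_irreducible P (w c)" "c \<noteq> 0" "degree F < degree P"
  shows "\<exists>f. Factorial_Ring.irreducible f \<and> degree f = degree P \<and> f - F \<in> coeffs_in (val_ge v N)"
proof -
  have "\<exists>h. \<forall>i. h i - coeff F i \<in> val_ge v N \<and> h i - coeff P i \<in> val_ge w (w c)"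
    using approximation[OF assms(2)] by (intro choice) blast
  then obtain h where h: "\<And>i. h i - coeff F i \<in> val_ge v N" "\<And>i. h i - coeff P i \<in> val_ge w (w c)"
    by blast
  define f where "f = (\<Sum>i\<le>degree P. Polynomial.monom (h i) i)"
  have co: "coeff f i = (if i \<le> degree P then h i else 0)" for i
    by (simp add: f_def coeff_sum)
  have fP: "f - P \<in> coeffs_in (val_ge w (w c))"
    using h(2) by (auto simp: coeffs_in_def co coeff_eq_0 W.fractional_zero)
  have fF: "f - F \<in> coeffs_in (val_ge v N)"
    using h(1) assms(3) by (auto simp: coeffs_in_def co coeff_eq_0 V.fractional_zero)
  have "0 < w c" "lead_coeff P \<notin> val_pos w"
    using P(1) by (auto simp: W.stably_irreducible_def)
  then have "h (degree P) \<notin> val_pos w"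
    using h(2)[of "degree P"] W.val_ge_subset_val_pos[of "w c"]
      W.fractional_diff_iff[OF W.fractional_val_pos] by blast
  then have "h (degree P) \<noteq> 0" by (auto simp: val_pos_def)
  then have "degree f = degree P"
    by (intro antisym le_degree degree_le) (auto simp: co)
  then show ?thesis using W.stably_irreducible_imp_irreducible[OF P(1) fP] fF by blast
qed

lemma irreducible_approximations:
  assumes stable: "\<And>D. \<exists>P c. D < degree P \<and> c \<noteq> 0 \<and> W.stably_irreducible P (w c)"
    and "finite B"
  shows "\<exists>f. (\<forall>i\<in>B. Factorial_Ring.irreducible (f i) \<and> f i - F i \<in> coeffs_in (val_ge v N)) \<and>
             inj_on (\<lambda>i. degree (f i)) B"
  using assms(2)
proof (induction B)
  case (insert b B)
  then obtain f where f: "\<And>i. i \<in> B \<Longrightarrow> Factorial_Ring.irreducible (f i) \<and> f i - F i \<in> coeffs_in (val_ge v N)"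
    "inj_on (\<lambda>i. degree (f i)) B" by blast
  obtain P c where P: "degree (F b) + (\<Sum>i\<in>B. degree (f i)) < degree P" "c \<noteq> 0" "W.stably_irreducible P (w c)"
    using stable by blast
  then obtain p where p: "Factorial_Ring.irreducible p" "degree p = degree P" "p - F b \<in> coeffs_in (val_ge v N)"
    using irreducible_approximation[OF P(3,2), of "F b" N] by auto
  have less: "degree (f i) < degree p" if "i \<in> B" for i
    using P(1) p(2) member_le_sum[of i B "\<lambda>i. degree (f i)"] insert.hyps(1) that by simp
  have "inj_on (\<lambda>i. degree ((f(b := p)) i)) (insert b B)"
  proof (rule inj_onI)
    fix i j assume "i \<in> insert b B" "j \<in> insert b B" "degree ((f(b := p)) i) = degree ((f(b := p)) j)"
    then show "i = j"
      using less[of i] less[of j] inj_onD[OF f(2), of i j]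
      by (cases "i = b"; cases "j = b") auto
  qed
  then show ?case using f(1) p insert.hyps(2) by (intro exI[of _ "f(b := p)"]) auto
qed simp

end

section \<open>Residue arithmetic in a valuation ring\<close>

context valued_field
begin

lemma integral_power: "x \<in> \<O> \<Longrightarrow> x ^ n \<in> \<O>"
  by (induction n) (auto intro: fractional_mult)

lemma power_val_pos: "x \<in> \<MM> \<Longrightarrow> 0 < n \<Longrightarrow> x ^ n \<in> \<MM>"
  using val_pos_mult[of "x ^ (n - 1)" x] integral_power[of x "n - 1"] val_pos_subset
  by (cases n) (auto simp: mult.commute)

lemma power_notin_val_pos: "x \<in> \<O> \<Longrightarrow> x \<notin> \<MM> \<Longrightarrow> x ^ n \<notin> \<MM>"
  using notin_val_pos[of x] val_power unit_notin by simp

lemma power_cong_one: "x \<in> \<O> \<Longrightarrow> x - 1 \<in> \<MM> \<Longrightarrow> x ^ n - 1 \<in> \<MM>"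
proof (induction n)
  case (Suc n)
  have "x * (x ^ n - 1) + (x - 1) \<in> \<MM>"
    using Suc by (intro fractional_add[OF fractional_val_pos] val_pos_mult) auto
  then show ?case by (simp add: algebra_simps)
qed (simp add: fractional_zero)

text \<open>
By the pigeonhole principle two of the powers \<open>1, x, \<dots>, x ^ card R\<close> of a unit agree modulo \<open>\<MM>\<close>, so
some positive exponent \<open>d \<le> card R\<close> has \<open>x ^ d = 1\<close> modulo \<open>\<MM>\<close>; the factorial is a common multiple
of all these \<open>d\<close>.
\<close>

lemma residue_exponent:
  assumes R: "finite R" "\<And>x. x \<in> \<O> \<Longrightarrow> \<exists>r\<in>R. x - r \<in> \<MM>"
  obtains N where "0 < N" "\<And>x. x \<in> \<O> \<Longrightarrow> x \<notin> \<MM> \<Longrightarrow> x ^ N - 1 \<in> \<MM>"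
proof
  show "0 < (fact (card R) :: nat)" by simp
  fix x assume x: "x \<in> \<O>" "x \<notin> \<MM>"
  have "\<exists>r. \<forall>i. r i \<in> R \<and> x ^ i - r i \<in> \<MM>"
    using R(2) integral_power[OF x(1)] by (intro choice) blast
  then obtain r where r: "\<And>i. r i \<in> R" "\<And>i. x ^ i - r i \<in> \<MM>" by blast
  have "card (r ` {..card R}) \<le> card R" using r(1) R(1) by (intro card_mono) auto
  then have "\<not> inj_on r {..card R}" using card_image[of r "{..card R}"] by auto
  then obtain i j where ij: "i < j" "j \<le> card R" "r i = r j"
    unfolding inj_on_def by (metis atMost_iff linorder_neqE_nat)
  have "(x ^ j - r j) - (x ^ i - r i) \<in> \<MM>"
    by (rule fractional_diff[OF fractional_val_pos r(2) r(2)])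
  moreover have "x ^ j = x ^ i * x ^ (j - i)" using ij(1) by (simp flip: power_add)
  ultimately have "x ^ i * (x ^ (j - i) - 1) \<in> \<MM>" using ij(3) by (simp add: algebra_simps)
  moreover have "x ^ (j - i) - 1 \<in> \<O>"
    using integral_power[OF x(1)] by (intro fractional_diff) auto
  ultimately have d: "x ^ (j - i) - 1 \<in> \<MM>"
    using val_pos_prime integral_power[OF x(1)] power_notin_val_pos[OF x] by blast
  have "j - i dvd fact (card R)" using ij by (intro dvd_fact) auto
  then obtain m where "fact (card R) = (j - i) * m" by (auto elim: dvdE)
  then show "x ^ fact (card R) - 1 \<in> \<MM>"
    using power_cong_one[OF integral_power[OF x(1)] d, of m] by (simp add: power_mult)
qed

lemma prod_in_val_pos_iff:
  assumes "finite S" "\<And>i. i \<in> S \<Longrightarrow> h i \<in> \<O>"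
  shows "prod h S \<in> \<O>" "prod h S \<in> \<MM> \<longleftrightarrow> (\<exists>i\<in>S. h i \<in> \<MM>)"
proof -
  have "prod h S \<in> \<O> \<and> (prod h S \<in> \<MM> \<longleftrightarrow> (\<exists>i\<in>S. h i \<in> \<MM>))"
    using assms
  proof (induction S)
    case (insert a S)
    then have *: "h a \<in> \<O>" "prod h S \<in> \<O>" "prod h S \<in> \<MM> \<longleftrightarrow> (\<exists>i\<in>S. h i \<in> \<MM>)" by auto
    have "h a * prod h S \<in> \<MM> \<longleftrightarrow> h a \<in> \<MM> \<or> prod h S \<in> \<MM>"
      using val_pos_prime[OF *(1,2)] val_pos_mult[OF *(1), of "prod h S"] val_pos_mult[OF *(2), of "h a"]
      by (auto simp: mult.commute)
    then show ?case using insert * fractional_mult[OF fractional_val_ge *(1,2)] by simp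
  qed simp
  then show "prod h S \<in> \<O>" "prod h S \<in> \<MM> \<longleftrightarrow> (\<exists>i\<in>S. h i \<in> \<MM>)" by auto
qed

end

section \<open>Integer-valued polynomials with prescribed zeros modulo the maximal ideal\<close>

locale discrete_valued_field = valued_field v for v :: "'a::Fields.field \<Rightarrow> int" +
  fixes \<pi> :: 'a
  assumes uniformizer: "\<pi> \<noteq> 0" "v \<pi> = 1"
begin

lemma val_pos_eq: "\<MM> = val_ge v 1"
  by (auto simp: val_pos_def val_ge_def)

lemma val_uniformizer_power [simp]: "v (\<pi> ^ n) = int n"
  by (induction n) (simp_all add: val_mult uniformizer)

end

locale finite_residue_valued_field = discrete_valued_field +
  fixes N :: nat
  assumes exponent_pos: "0 < N" and unit_power: "\<And>x. x \<in> \<O> \<Longrightarrow> x \<notin> \<MM> \<Longrightarrow> x ^ N - 1 \<in> \<MM>"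
begin

text \<open>
It is integer-valued because \<open>x^(N+1) = x\<close> modulo \<open>\<MM>\<close> for all \<open>x\<close> in the valuation ring, and at \<open>\<pi> * u\<close> it
equals \<open>u * (\<pi>^N * u^N - 1)\<close>, a unit multiple of \<open>u\<close>: on \<open>\<MM>\<close> it removes one factor \<open>\<pi>\<close>.
\<close>

definition shift :: "'a poly" where
  "shift = smult (inverse \<pi>) (Polynomial.monom 1 (Suc N) - Polynomial.monom 1 1)"

lemma poly_shift: "poly shift x = inverse \<pi> * (x * (x ^ N - 1))"
  by (simp add: shift_def poly_monom algebra_simps)

lemma shift_integral:
  assumes "x \<in> \<O>"
  shows "poly shift x \<in> \<O>"
proof -
  have "x * (x ^ N - 1) \<in> \<MM>"
  proof (cases "x \<in> \<MM>")
    case True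
    then show ?thesis
      using val_pos_mult[of "x ^ N - 1" x] integral_power[OF assms, of N]
        fractional_diff[OF fractional_val_ge, of "x ^ N" 0 1] one_in by (metis mult.commute)
  next
    case False
    then show ?thesis using unit_power val_pos_mult assms by blast
  qed
  then show ?thesis
    using val_ge_mult[of "inverse \<pi>" "- 1" "x * (x ^ N - 1)" 1] val_inverse[of \<pi>] uniformizer
    unfolding poly_shift val_pos_eq by (simp add: val_ge_def)
qed

lemma shift_lowers_value:
  assumes "x \<in> \<MM>"
  shows "poly shift x \<in> val_ge v (int n) \<longleftrightarrow> x \<in> val_ge v (int (Suc n))"
proof (cases "x = 0")
  case True
  then show ?thesis by (simp add: poly_shift val_ge_def)
next
  case False
  have "x ^ N - 1 \<notin> \<MM>"
    using fractional_diff[OF fractional_val_pos power_val_pos[OF assms exponent_pos], of "x ^ N - 1"] by auto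
  moreover have "x ^ N - 1 \<in> \<O>"
    using integral_power[of x N] assms val_pos_subset by (intro fractional_diff) auto
  ultimately have u: "x ^ N - 1 \<noteq> 0" "v (x ^ N - 1) = 0" using notin_val_pos by blast+
  have "v (poly shift x) = v x - 1"
    using val_mult[of "inverse \<pi>" "x * (x ^ N - 1)"] val_mult[of x "x ^ N - 1"] u False
      val_inverse[of \<pi>] uniformizer by (simp add: poly_shift)
  then show ?thesis using u False uniformizer by (auto simp: val_ge_def poly_shift)
qed

text \<open>
Modulo \<open>\<MM>\<close>, the indicator function of the ball of all \<open>x\<close> with \<open>v x \<ge> n\<close>: a point \<open>x\<close> lies in the
ball for \<open>n + 1\<close> exactly if it lies in \<open>\<MM>\<close> and its shift lies in the ball for \<open>n\<close>.
\<close>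

primrec ball_indicator :: "nat \<Rightarrow> 'a poly" where
  "ball_indicator 0 = 1"
| "ball_indicator (Suc n) = (1 - Polynomial.monom 1 N) * pcompose (ball_indicator n) shift"

lemma cong_one_integral: "x - 1 \<in> \<MM> \<Longrightarrow> x \<in> \<O>"
  using fractional_diff_iff[OF fractional_val_ge, of x 1 0] val_pos_subset by auto

lemma cong_one_notin: "x - 1 \<in> \<MM> \<Longrightarrow> x \<notin> \<MM>"
  using fractional_diff_iff[OF fractional_val_pos, of x 1] by simp

lemma ball_indicator:
  assumes "x \<in> \<O>"
  shows "(x \<in> val_ge v (int n) \<longrightarrow> poly (ball_indicator n) x - 1 \<in> \<MM>) \<and>
         (x \<notin> val_ge v (int n) \<longrightarrow> poly (ball_indicator n) x \<in> \<MM>)"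
  using assms
proof (induction n arbitrary: x)
  case 0
  then show ?case by (simp add: fractional_zero)
next
  case (Suc n)
  let ?b = "poly (ball_indicator n) (poly shift x)"
  have IH: "(poly shift x \<in> val_ge v (int n) \<longrightarrow> ?b - 1 \<in> \<MM>) \<and> (poly shift x \<notin> val_ge v (int n) \<longrightarrow> ?b \<in> \<MM>)"
    by (rule Suc.IH[OF shift_integral[OF Suc.prems]])
  have eq: "poly (ball_indicator (Suc n)) x = (1 - x ^ N) * ?b"
    by (simp add: poly_pcompose poly_monom)
  have b: "?b \<in> \<O>" using IH cong_one_integral val_pos_subset by blast
  show ?case
  proof (cases "x \<in> \<MM>")
    case True
    have "x ^ N * ?b \<in> \<MM>"
      using val_pos_mult[OF b power_val_pos[OF True exponent_pos]] by (simp add: mult.commute)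
    moreover have "poly (ball_indicator (Suc n)) x - ?b = - (x ^ N * ?b)"
      unfolding eq by (simp add: algebra_simps)
    ultimately have diff: "poly (ball_indicator (Suc n)) x - ?b \<in> \<MM>"
      using fractional_uminus[OF fractional_val_pos] by metis
    have "poly (ball_indicator (Suc n)) x - 1 \<in> \<MM>" if "?b - 1 \<in> \<MM>"
      using fractional_add[OF fractional_val_pos diff that] by simp
    then show ?thesis
      using IH shift_lowers_value[OF True, of n] fractional_diff_iff[OF fractional_val_pos diff] by blast
  next
    case False
    then have "x \<notin> val_ge v (int (Suc n))" by (auto simp: val_pos_def val_ge_def)
    moreover have "- (x ^ N - 1) \<in> \<MM>"
      using unit_power[OF Suc.prems False] by (rule fractional_uminus[OF fractional_val_pos])
    then have "(1 - x ^ N) * ?b \<in> \<MM>" using val_pos_mult[OF b] by (simp add: mult.commute)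
    ultimately show ?thesis unfolding eq by blast
  qed
qed

definition shell :: "nat \<Rightarrow> 'a set" where
  "shell y = {x. x \<noteq> 0 \<and> v x = int y}"

definition shell_indicator :: "nat \<Rightarrow> 'a poly" where
  "shell_indicator y = ball_indicator y - ball_indicator (Suc y)"

lemma shell_indicator:
  assumes "x \<in> \<O>"
  shows "x \<in> shell y \<Longrightarrow> poly (shell_indicator y) x - 1 \<in> \<MM>"
    and "x \<notin> shell y \<Longrightarrow> poly (shell_indicator y) x \<in> \<MM>"
proof -
  let ?a = "poly (ball_indicator y) x" and ?b = "poly (ball_indicator (Suc y)) x"
  have shell: "x \<in> shell y \<longleftrightarrow> x \<in> val_ge v (int y) \<and> x \<notin> val_ge v (int (Suc y))"
    by (auto simp: shell_def val_ge_def)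
  note a = ball_indicator[OF assms, of y] and b = ball_indicator[OF assms, of "Suc y"]
  show "poly (shell_indicator y) x - 1 \<in> \<MM>" if "x \<in> shell y"
    using fractional_diff[OF fractional_val_pos, of "?a - 1" ?b] a b that shell
    by (simp add: shell_indicator_def algebra_simps)
  show "poly (shell_indicator y) x \<in> \<MM>" if "x \<notin> shell y"
  proof (cases "x \<in> val_ge v (int y)")
    case True
    then show ?thesis
      using fractional_diff[OF fractional_val_pos, of "?a - 1" "?b - 1"] a b that shell
      by (simp add: shell_indicator_def)
  next
    case False
    then have "x \<notin> val_ge v (int (Suc y))" by (auto simp: val_ge_def)
    then show ?thesis
      using fractional_diff[OF fractional_val_pos, of ?a ?b] a b False by (simp add: shell_indicator_def)
  qed
qed

lemma shells_polynomial:
  assumes Y: "finite Y" and x: "x \<in> \<O>"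
  shows "(\<exists>y\<in>Y. x \<in> shell y) \<Longrightarrow> poly (1 - (\<Sum>y\<in>Y. shell_indicator y)) x \<in> \<MM>"
    and "\<not> (\<exists>y\<in>Y. x \<in> shell y) \<Longrightarrow> poly (1 - (\<Sum>y\<in>Y. shell_indicator y)) x - 1 \<in> \<MM>"
proof -
  have sum: "(\<Sum>y\<in>Z. poly (shell_indicator y) x) \<in> \<MM>" if "\<And>y. y \<in> Z \<Longrightarrow> x \<notin> shell y" for Z
    using that shell_indicator(2)[OF x] by (intro fractional_sum) auto
  show "poly (1 - (\<Sum>y\<in>Y. shell_indicator y)) x - 1 \<in> \<MM>" if "\<not> (\<exists>y\<in>Y. x \<in> shell y)"
    using fractional_uminus[OF fractional_val_pos sum[of Y]] that by (simp add: poly_sum)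
  show "poly (1 - (\<Sum>y\<in>Y. shell_indicator y)) x \<in> \<MM>" if ex: "\<exists>y\<in>Y. x \<in> shell y"
  proof -
    obtain y where y: "y \<in> Y" "x \<in> shell y" using ex by blast
    have "(\<Sum>z\<in>Y - {y}. poly (shell_indicator z) x) \<in> \<MM>"
      using y(2) by (intro sum) (auto simp: shell_def)
    then have "(poly (shell_indicator y) x - 1) + (\<Sum>z\<in>Y - {y}. poly (shell_indicator z) x) \<in> \<MM>"
      using shell_indicator(1)[OF x y(2)] by (intro fractional_add) auto
    then have "- ((poly (shell_indicator y) x - 1) + (\<Sum>z\<in>Y - {y}. poly (shell_indicator z) x)) \<in> \<MM>"
      by (rule fractional_uminus[OF fractional_val_pos])
    then show ?thesis by (simp add: poly_sum sum.remove[OF Y y(1)] algebra_simps)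
  qed
qed

text \<open>
The sets \<open>T \<in> \<T>\<close> are numbered by \<open>y < E\<close> and attached to the shells of value \<open>y\<close>. For \<open>i \<in> A\<close> the
polynomial \<open>f i\<close> is divisible by \<open>\<pi>\<close> exactly on the shells of the sets containing \<open>i\<close>, and \<open>f c\<close>
exactly on the ball \<open>v x \<ge> E\<close>. So a product over \<open>S\<close> has all its values in \<open>\<MM>\<close> iff each of these
shells and the ball is taken care of by some \<open>i \<in> S\<close>. All this depends on values modulo \<open>\<pi>^2\<close> only
and therefore survives the passage to irreducible approximations.
\<close>

lemma cover_polynomials:
  assumes approx: "\<And>F. \<exists>f. (\<forall>i\<in>insert c A. Factorial_Ring.irreducible (f i) \<and> f i - F i \<in> coeffs_in (val_ge v 2)) \<and>
             inj_on (\<lambda>i. degree (f i)) (insert c A)"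
    and A: "finite A" "c \<notin> A" and T: "finite \<T>" "\<Union>\<T> \<subseteq> A"
  shows "\<exists>f. (\<forall>i\<in>insert c A. Factorial_Ring.irreducible (f i) \<and> f i \<in> Int_poly \<O>) \<and>
             inj_on (\<lambda>i. degree (f i)) (insert c A) \<and>
             (\<forall>i\<in>A. poly (f i) 0 \<notin> \<MM>) \<and> poly (f c) 0 \<notin> val_ge v 2 \<and>
             (\<forall>S\<subseteq>insert c A. (\<forall>x\<in>\<O>. poly (\<Prod>i\<in>S. f i) x \<in> \<MM>) \<longleftrightarrow> c \<in> S \<and> (\<forall>T\<in>\<T>. S \<inter> T \<noteq> {}))"
proof -
  obtain E :: nat and T where \<T>: "\<T> = T ` {i. i < E}"
    using finite_imp_nat_seg_image_inj_on[OF T(1)] by blast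
  define Y where "Y i = {y. y < E \<and> i \<in> T y}" for i
  have finY: "finite (Y i)" for i unfolding Y_def by simp
  \<comment> \<open>The constant corrects the polynomial of \<open>c\<close> to have the exact value \<open>\<pi>\<close> at \<open>0\<close>; it lies in
  \<open>\<MM>\<close>, since the ball indicator is congruent to \<open>1\<close> at \<open>0\<close>.\<close>
  define \<kappa> where "\<kappa> = \<pi> - 1 + poly (ball_indicator E) 0"
  define F where "F i = (if i = c then 1 - ball_indicator E + [:\<kappa>:]
    else 1 - (\<Sum>y\<in>Y i. shell_indicator y))" for i
  obtain f where f: "\<And>i. i \<in> insert c A \<Longrightarrow> Factorial_Ring.irreducible (f i)"
      "\<And>i. i \<in> insert c A \<Longrightarrow> f i - F i \<in> coeffs_in (val_ge v 2)"
    and inj: "inj_on (\<lambda>i. degree (f i)) (insert c A)"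
    using approx[of F] by blast
  have zero: "0 \<in> val_ge v g" for g by (simp add: val_ge_def)
  have "\<pi> \<in> \<MM>" using uniformizer by (simp add: val_pos_def)
  then have "\<pi> + (poly (ball_indicator E) 0 - 1) \<in> \<MM>"
    using ball_indicator[of 0 E] zero fractional_add[OF fractional_val_pos] by blast
  then have \<kappa>: "\<kappa> \<in> \<MM>" by (simp add: \<kappa>_def algebra_simps)
  have close: "poly (f i) x - poly (F i) x \<in> val_ge v 2" if "i \<in> insert c A" "x \<in> \<O>" for i x
    using poly_in[OF fractional_val_ge f(2)[OF that(1)] that(2)] by simp
  have val_2: "val_ge v 2 \<subseteq> \<MM>" by (auto simp: val_ge_def val_pos_def)
  have dichotomy: "poly (f i) x \<in> \<O> \<and> (poly (f i) x \<in> \<MM> \<longleftrightarrow> P)"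
    if "i \<in> insert c A" "x \<in> \<O>" and F: "P \<Longrightarrow> poly (F i) x \<in> \<MM>" "\<not> P \<Longrightarrow> poly (F i) x - 1 \<in> \<MM>" for i x P
  proof -
    have "poly (f i) x - poly (F i) x \<in> \<MM>" using close[OF that(1,2)] val_2 by blast
    moreover from this have "poly (f i) x - poly (F i) x \<in> \<O>" using val_pos_subset by blast
    ultimately have "poly (f i) x \<in> \<O> \<longleftrightarrow> poly (F i) x \<in> \<O>" "poly (f i) x \<in> \<MM> \<longleftrightarrow> poly (F i) x \<in> \<MM>"
      using fractional_diff_iff[OF fractional_val_ge] fractional_diff_iff[OF fractional_val_pos] by blast+
    then show ?thesis using F cong_one_integral cong_one_notin val_pos_subset by blast
  qed
  have value_A: "poly (f i) x \<in> \<O> \<and> (poly (f i) x \<in> \<MM> \<longleftrightarrow> (\<exists>y\<in>Y i. x \<in> shell y))"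
    if "i \<in> A" "x \<in> \<O>" for i x
    using that A(2) shells_polynomial[OF finY that(2)] by (intro dichotomy) (auto simp: F_def)
  have value_c: "poly (f c) x \<in> \<O> \<and> (poly (f c) x \<in> \<MM> \<longleftrightarrow> x \<in> val_ge v (int E))"
    if x: "x \<in> \<O>" for x
  proof (rule dichotomy)
    note b = ball_indicator[OF x, of E]
    show "poly (F c) x \<in> \<MM>" if "x \<in> val_ge v (int E)"
      using fractional_diff[OF fractional_val_pos \<kappa>, of "poly (ball_indicator E) x - 1"] b that
      by (simp add: F_def algebra_simps)
    show "poly (F c) x - 1 \<in> \<MM>" if "x \<notin> val_ge v (int E)"
      using fractional_diff[OF fractional_val_pos \<kappa>, of "poly (ball_indicator E) x"] b that
      by (simp add: F_def algebra_simps)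
  qed (use x in auto)
  have integral: "poly (f i) x \<in> \<O>" if "i \<in> insert c A" "x \<in> \<O>" for i x
    using that value_A value_c by blast
  have "poly (f c) 0 \<notin> val_ge v 2"
  proof
    assume "poly (f c) 0 \<in> val_ge v 2"
    then have "poly (F c) 0 \<in> val_ge v 2"
      using close[of c 0] zero fractional_diff_iff[OF fractional_val_ge] by blast
    then show False using uniformizer by (simp add: F_def \<kappa>_def val_ge_def)
  qed
  moreover have "poly (f i) 0 \<notin> \<MM>" if "i \<in> A" for i
    using value_A[OF that zero] by (simp add: shell_def)
  moreover have "(\<forall>x\<in>\<O>. poly (\<Prod>i\<in>S. f i) x \<in> \<MM>) \<longleftrightarrow> c \<in> S \<and> (\<forall>T\<in>\<T>. S \<inter> T \<noteq> {})"
    if S: "S \<subseteq> insert c A" for S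
  proof -
    have prod: "poly (\<Prod>i\<in>S. f i) x \<in> \<MM> \<longleftrightarrow> (\<exists>i\<in>S. poly (f i) x \<in> \<MM>)" if "x \<in> \<O>" for x
    proof -
      have "finite S" using finite_subset[OF S] A(1) by blast
      moreover have "poly (f i) x \<in> \<O>" if "i \<in> S" for i using that S integral \<open>x \<in> \<O>\<close> by blast
      ultimately show ?thesis using prod_in_val_pos_iff(2)[of S "\<lambda>i. poly (f i) x"] by (simp add: poly_prod)
    qed
    show ?thesis unfolding \<T>
    proof (intro iffI conjI ballI)
      assume *: "\<forall>x\<in>\<O>. poly (\<Prod>i\<in>S. f i) x \<in> \<MM>"
      obtain i where "i \<in> S" "poly (f i) 0 \<in> \<MM>" using * prod zero by blast
      then show "c \<in> S" using value_A[of i 0] S zero by (auto simp: shell_def)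
      fix T' assume "T' \<in> T ` {i. i < E}"
      then obtain y where y: "T' = T y" "y < E" by blast
      have \<pi>y: "\<pi> ^ y \<in> \<O>" "\<pi> ^ y \<notin> val_ge v (int E)"
        using uniformizer y(2) by (simp_all add: val_ge_def)
      then obtain i where i: "i \<in> S" "poly (f i) (\<pi> ^ y) \<in> \<MM>" using * prod by blast
      then have "i \<in> A" using value_c[OF \<pi>y(1)] \<pi>y(2) S by blast
      then obtain z where "z \<in> Y i" "\<pi> ^ y \<in> shell z" using value_A \<pi>y(1) i(2) by blast
      then have "i \<in> T y" by (simp add: Y_def shell_def)
      then show "S \<inter> T' \<noteq> {}" using i(1) y(1) by blast
    next
      fix x assume *: "c \<in> S \<and> (\<forall>T\<in>T ` {i. i < E}. S \<inter> T \<noteq> {})" and x: "x \<in> \<O>"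
      show "poly (\<Prod>i\<in>S. f i) x \<in> \<MM>"
      proof (cases "x \<in> val_ge v (int E)")
        case True
        then show ?thesis using prod[OF x] * value_c[OF x] by blast
      next
        case False
        then have "x \<noteq> 0" "0 \<le> v x" "v x < int E" using x by (auto simp: val_ge_def)
        then have y: "x \<in> shell (nat (v x))" "nat (v x) < E" by (auto simp: shell_def)
        then obtain i where i: "i \<in> S" "i \<in> T (nat (v x))" using * by blast
        then have "i \<in> A" using T(2) y(2) unfolding \<T> by blast
        moreover have "nat (v x) \<in> Y i" using i y by (simp add: Y_def)
        ultimately show ?thesis using prod[OF x] i(1) value_A[OF _ x] y(1) by blast
      qed
    qed
  qed
  ultimately show ?thesis
    using f(1) inj integral by (intro exI[of _ f]) (auto simp: Int_poly_def)
qed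

end

section \<open>Factors of a product of irreducible polynomials over a field\<close>

lemma irreducible_poly_degree_pos:
  fixes p :: "'a::Fields.field poly"
  assumes "Factorial_Ring.irreducible p"
  shows "0 < degree p"
proof -
  have "p \<noteq> 0" "\<not> p dvd 1" using assms by (auto simp: Factorial_Ring.irreducible_def)
  then show ?thesis by (auto simp: is_unit_iff_degree)
qed

text \<open>
Unique factorization in the form needed below: each \<open>f s\<close> is prime and can be cancelled from one of
the two factors. Some of the \<open>f i\<close> may be associated, so \<open>T\<close> need not be unique.
\<close>

lemma factor_of_product:
  fixes f :: "'i \<Rightarrow> 'a::Fields.field poly"
  assumes "finite S" "\<And>i. i \<in> S \<Longrightarrow> Factorial_Ring.irreducible (f i)" "u \<noteq> 0"
    "p * q = smult u (\<Prod>i\<in>S. f i)"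
  shows "\<exists>T \<alpha> \<beta>. T \<subseteq> S \<and> \<alpha> \<noteq> 0 \<and> \<beta> \<noteq> 0 \<and> \<alpha> * \<beta> = u \<and>
    p = smult \<alpha> (\<Prod>i\<in>T. f i) \<and> q = smult \<beta> (\<Prod>i\<in>S - T. f i)"
  using assms
proof (induction S arbitrary: p q)
  case empty
  then have "p \<noteq> 0" "q \<noteq> 0" "degree (p * q) = 0" by auto
  then have "degree p = 0" "degree q = 0" by (auto simp: degree_mult_eq)
  then obtain \<alpha> \<beta> where "p = [:\<alpha>:]" "q = [:\<beta>:]" by (metis degree_eq_zeroE)
  then show ?case using empty \<open>p \<noteq> 0\<close> \<open>q \<noteq> 0\<close>
    by (intro exI[of _ "{}"] exI[of _ \<alpha>] exI[of _ \<beta>]) (auto simp: smult_one)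
next
  case (insert s S)
  have eq: "p * q = f s * smult u (\<Prod>i\<in>S. f i)" using insert by simp
  have s0: "f s \<noteq> 0" using insert.prems(1)[of s] by auto
  have "prime_elem (f s)" using insert.prems(1) by (intro field_poly_irreducible_imp_prime) simp
  moreover have "f s dvd p * q" unfolding eq by (rule dvd_triv_left)
  ultimately have "f s dvd p \<or> f s dvd q" by (rule prime_elem_dvd_multD)
  then show ?case
  proof
    assume "f s dvd p"
    then obtain p' where p': "p = f s * p'" by (elim dvdE)
    then have "f s * (p' * q) = f s * smult u (\<Prod>i\<in>S. f i)" using eq by (simp only: p' mult.assoc)
    then have "p' * q = smult u (\<Prod>i\<in>S. f i)" using s0 unfolding mult_cancel_left by blast
    then obtain T \<alpha> \<beta> where "T \<subseteq> S" "\<alpha> \<noteq> 0" "\<beta> \<noteq> 0" "\<alpha> * \<beta> = u"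
      "p' = smult \<alpha> (\<Prod>i\<in>T. f i)" "q = smult \<beta> (\<Prod>i\<in>S - T. f i)"
      using insert.IH[of p' q] insert.prems by auto
    moreover have "s \<notin> T" "finite T" using insert.hyps \<open>T \<subseteq> S\<close> finite_subset by auto
    moreover have "insert s S - insert s T = S - T" using insert.hyps by auto
    ultimately show ?thesis
      by (intro exI[of _ "insert s T"] exI[of _ \<alpha>] exI[of _ \<beta>]) (auto simp: p')
  next
    assume "f s dvd q"
    then obtain q' where q': "q = f s * q'" by (elim dvdE)
    then have "f s * (p * q') = f s * smult u (\<Prod>i\<in>S. f i)" using eq by (simp only: q' mult.left_commute)
    then have "p * q' = smult u (\<Prod>i\<in>S. f i)" using s0 unfolding mult_cancel_left by blast
    then obtain T \<alpha> \<beta> where "T \<subseteq> S" "\<alpha> \<noteq> 0" "\<beta> \<noteq> 0" "\<alpha> * \<beta> = u"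
      "p = smult \<alpha> (\<Prod>i\<in>T. f i)" "q' = smult \<beta> (\<Prod>i\<in>S - T. f i)"
      using insert.IH[of p q'] insert.prems by auto
    moreover have "insert s S - T = insert s (S - T)" "s \<notin> S - T" "finite (S - T)"
      using insert.hyps \<open>T \<subseteq> S\<close> by auto
    ultimately show ?thesis
      by (intro exI[of _ T] exI[of _ \<alpha>] exI[of _ \<beta>]) (auto simp: q')
  qed
qed

lemma factors_of_product:
  fixes f :: "'i \<Rightarrow> 'a::Fields.field poly"
  assumes "finite S" "\<And>i. i \<in> S \<Longrightarrow> Factorial_Ring.irreducible (f i)" "u \<noteq> 0"
    "prod_list ps = smult u (\<Prod>i\<in>S. f i)"
  shows "\<exists>zs. ps = map (\<lambda>(\<alpha>, T). smult \<alpha> (\<Prod>i\<in>T. f i)) zs \<and> (\<forall>z\<in>set zs. fst z \<noteq> 0) \<and>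
    prod_list (map fst zs) = u \<and> \<Union>(snd ` set zs) = S \<and> sorted_wrt (\<lambda>z z'. snd z \<inter> snd z' = {}) zs"
  using assms
proof (induction ps arbitrary: S u)
  case Nil
  have "degree (\<Prod>i\<in>S. f i) = 0"
    using Nil.prems(3,4) by (metis degree_1 degree_smult_eq prod_list.Nil)
  moreover have "\<forall>i\<in>S. degree (f i) > 0 \<and> f i \<noteq> 0"
    using Nil.prems(2) irreducible_poly_degree_pos by force
  ultimately have "S = {}"
    using Nil.prems(1) by (auto simp: degree_prod_eq_sum_degree)
  moreover from this have "u = 1" using Nil.prems(4) by (simp add: smult_one one_pCons)
  ultimately show ?case by (intro exI[of _ "[]"]) simp
next
  case (Cons p ps)
  obtain T \<alpha> \<beta> where T: "T \<subseteq> S" "\<alpha> \<noteq> 0" "\<beta> \<noteq> 0" "\<alpha> * \<beta> = u"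
    "p = smult \<alpha> (\<Prod>i\<in>T. f i)" "prod_list ps = smult \<beta> (\<Prod>i\<in>S - T. f i)"
    using factor_of_product[where f = f, OF Cons.prems(1,2,3), of p "prod_list ps"] Cons.prems(4) by auto
  obtain zs where zs: "ps = map (\<lambda>(\<alpha>, T). smult \<alpha> (\<Prod>i\<in>T. f i)) zs" "\<forall>z\<in>set zs. fst z \<noteq> 0"
    "prod_list (map fst zs) = \<beta>" "\<Union>(snd ` set zs) = S - T" "sorted_wrt (\<lambda>z z'. snd z \<inter> snd z' = {}) zs"
    using Cons.IH[OF _ _ T(3,6)] Cons.prems(1,2) by auto
  have "T \<inter> snd z = {}" if "z \<in> set zs" for z using zs(4) that by blast
  then show ?case using T zs by (intro exI[of _ "(\<alpha>, T) # zs"]) auto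
qed

section \<open>Factorizations governed by vertex covers\<close>

text \<open>
The index set \<open>A\<close> is partitioned by \<open>grp\<close> into the parts of a complete multipartite graph; the last
assumption relates products of the \<open>f i\<close> to vertex covers of this graph, enlarged by the isolated
compulsory vertex \<open>c\<close>.
\<close>

locale vertex_cover_family = discrete_valued_field v \<pi>
  for v :: "'a::Fields.field \<Rightarrow> int" and \<pi> :: 'a +
  fixes A :: "'i set" and c :: 'i and grp :: "'i \<Rightarrow> nat" and f :: "'i \<Rightarrow> 'a poly"
  assumes finite_A: "finite A" and c_notin: "c \<notin> A" and A_nonempty: "A \<noteq> {}"
    and irreducible_f: "i \<in> insert c A \<Longrightarrow> Factorial_Ring.irreducible (f i)"
    and integral_f: "i \<in> insert c A \<Longrightarrow> f i \<in> Int_poly (val_ge v 0)"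
    and inj_degree: "inj_on (\<lambda>i. degree (f i)) (insert c A)"
    and unit_at_0: "i \<in> A \<Longrightarrow> poly (f i) 0 \<notin> val_pos v"
    and value_c_at_0: "poly (f c) 0 \<notin> val_ge v 2"
    and cover: "S \<subseteq> insert c A \<Longrightarrow> (\<forall>x\<in>val_ge v 0. poly (\<Prod>i\<in>S. f i) x \<in> val_pos v) \<longleftrightarrow>
      c \<in> S \<and> (\<forall>a\<in>A. \<forall>b\<in>A. grp a \<noteq> grp b \<longrightarrow> a \<in> S \<or> b \<in> S)"
begin

abbreviation "IntR \<equiv> ring_on (Int_poly \<O>)"

definition is_cover :: "'i set \<Rightarrow> bool" where
  "is_cover S \<longleftrightarrow> c \<in> S \<and> (\<forall>a\<in>A. \<forall>b\<in>A. grp a \<noteq> grp b \<longrightarrow> a \<in> S \<or> b \<in> S)"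

definition fibre :: "nat \<Rightarrow> 'i set" where "fibre j = {a \<in> A. grp a = j}"

definition mincover :: "nat \<Rightarrow> 'i set" where "mincover j = insert c (A - fibre j)"

abbreviation P :: "'i set \<Rightarrow> 'a poly" where "P S \<equiv> \<Prod>i\<in>S. f i"

lemma finite_subset_index: "S \<subseteq> insert c A \<Longrightarrow> finite S"
  using finite_A finite_subset by blast

lemma degree_f_pos: "i \<in> insert c A \<Longrightarrow> 0 < degree (f i)"
  using irreducible_f irreducible_poly_degree_pos by blast

lemma f_nonzero: "i \<in> insert c A \<Longrightarrow> f i \<noteq> 0"
  using degree_f_pos by fastforce

lemma P_nonzero: "S \<subseteq> insert c A \<Longrightarrow> P S \<noteq> 0"
  using f_nonzero finite_subset_index[of S] by auto

lemma degree_P: "S \<subseteq> insert c A \<Longrightarrow> degree (P S) = (\<Sum>i\<in>S. degree (f i))"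
  using f_nonzero by (intro degree_prod_eq_sum_degree) auto

lemma degree_P_pos: "S \<subseteq> insert c A \<Longrightarrow> S \<noteq> {} \<Longrightarrow> 0 < degree (P S)"
proof -
  assume S: "S \<subseteq> insert c A" "S \<noteq> {}"
  then obtain i where i: "i \<in> S" by blast
  have "degree (f i) \<le> degree (P S)"
    unfolding degree_P[OF S(1)] using i finite_subset_index[OF S(1)] by (intro member_le_sum) auto
  then show ?thesis using degree_f_pos[of i] i S(1) by force
qed

lemma P_at_0:
  assumes "S \<subseteq> A"
  shows "poly (P S) 0 \<noteq> 0" "v (poly (P S) 0) = 0"
proof -
  have S: "finite S" "\<And>i. i \<in> S \<Longrightarrow> poly (f i) 0 \<in> \<O>"
    using assms finite_A finite_subset integral_f fractional_zero[OF fractional_val_ge]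
    by (auto simp: Int_poly_def)
  then have "poly (P S) 0 \<in> \<O>" "poly (P S) 0 \<notin> \<MM>"
    using prod_in_val_pos_iff[of S "\<lambda>i. poly (f i) 0"] assms unit_at_0 by (auto simp: poly_prod)
  then show "poly (P S) 0 \<noteq> 0" "v (poly (P S) 0) = 0" using notin_val_pos by auto
qed

lemma subring_Int: "subring (Int_poly \<O>) (ring_on UNIV)"
  using subring_Int_poly[OF subring_valuation_ring[OF valuation]] by (simp add: valuation_ring_eq)

lemma Int_domain: "domain IntR"
  using domain_ring_on[OF subring_Int] .

lemma Int_mult: "p \<in> Int_poly \<O> \<Longrightarrow> q \<in> Int_poly \<O> \<Longrightarrow> p * q \<in> Int_poly \<O>"
  using fractional_mult[OF fractional_val_ge] by (auto simp: Int_poly_def)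

lemma Int_smult: "u \<in> \<O> \<Longrightarrow> p \<in> Int_poly \<O> \<Longrightarrow> smult u p \<in> Int_poly \<O>"
  using fractional_mult[OF fractional_val_ge] by (auto simp: Int_poly_def)

lemma Int_P: "S \<subseteq> insert c A \<Longrightarrow> P S \<in> Int_poly \<O>"
  using prod_in_val_pos_iff(1)[of S] finite_subset_index[of S] integral_f
  by (auto simp: Int_poly_def poly_prod subset_iff)

lemma Units_Int: "p \<in> Units IntR \<longleftrightarrow> (\<exists>u. u \<noteq> 0 \<and> v u = 0 \<and> p = [:u:])"
proof
  assume "p \<in> Units IntR"
  then obtain q where pq: "p \<in> Int_poly \<O>" "q \<in> Int_poly \<O>" "p * q = 1"
    unfolding Units_def by (auto simp: mult.commute)
  then have "p dvd 1" "q dvd 1" by (metis dvd_triv_left, metis dvd_triv_right)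
  then obtain \<alpha> \<beta> where pq': "p = [:\<alpha>:]" "q = [:\<beta>:]" by (auto simp: is_unit_poly_iff)
  have zero: "0 \<in> \<O>" by (simp add: val_ge_def)
  have ab: "\<alpha> * \<beta> = 1" using pq(3) by (simp add: pq' one_pCons mult.commute)
  then have nz: "\<alpha> \<noteq> 0" "\<beta> \<noteq> 0" by auto
  have "0 \<le> v \<alpha>" "0 \<le> v \<beta>" using pq(1,2) zero nz by (auto simp: Int_poly_def pq' val_ge_def)
  moreover have "v \<alpha> + v \<beta> = 0" using ab val_mult[OF nz] by simp
  ultimately show "\<exists>u. u \<noteq> 0 \<and> v u = 0 \<and> p = [:u:]" using nz pq' by (intro exI[of _ \<alpha>]) auto
next
  assume "\<exists>u. u \<noteq> 0 \<and> v u = 0 \<and> p = [:u:]"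
  then obtain u where u: "u \<noteq> 0" "v u = 0" "p = [:u:]" by blast
  then have "[:u:] \<in> Int_poly \<O>" "[:inverse u:] \<in> Int_poly \<O>"
    using val_inverse[of u] by (auto simp: Int_poly_def val_ge_def)
  moreover have "[:u:] * [:inverse u:] = 1" "[:inverse u:] * [:u:] = 1"
    using u(1) by (simp_all add: one_pCons)
  ultimately show "p \<in> Units IntR" unfolding Units_def u(3) ring_on_simps by blast
qed

lemma nonunit_of_degree_pos: "0 < degree p \<Longrightarrow> p \<notin> Units IntR"
  by (auto simp: Units_Int)

lemma irreducible_Int_iff:
  "p \<in> Int_poly \<O> \<Longrightarrow> ring_irreducible\<^bsub>IntR\<^esub> p \<longleftrightarrow> p \<noteq> 0 \<and> p \<notin> Units IntR \<and>
    (\<forall>a\<in>Int_poly \<O>. \<forall>b\<in>Int_poly \<O>. p = a * b \<longrightarrow> a \<in> Units IntR \<or> b \<in> Units IntR)"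
  using domain.ring_irreducible_iff[OF Int_domain, of p] by auto

text \<open>
The value at \<open>0\<close> bounds the denominator: \<open>f c\<close> contributes at most \<open>1\<close> there, and the other \<open>f i\<close>
contribute nothing. A genuine denominator forces all values of the product into \<open>\<MM>\<close>.
\<close>

lemma Int_smult_P_imp:
  assumes S: "S \<subseteq> insert c A" and u: "u \<noteq> 0" and int: "smult u (P S) \<in> Int_poly \<O>"
  shows "- 1 \<le> v u" and "c \<notin> S \<Longrightarrow> 0 \<le> v u" and "v u < 0 \<Longrightarrow> is_cover S"
proof -
  have zero: "0 \<in> \<O>" by (simp add: val_ge_def)
  have at0: "u * poly (P S) 0 \<in> \<O>" using int zero by (auto simp: Int_poly_def)
  show c: "0 \<le> v u" if "c \<notin> S"
  proof -
    have "S \<subseteq> A" using S that by blast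
    then show ?thesis using at0 P_at_0[of S] u val_mult[of u "poly (P S) 0"] by (auto simp: val_ge_def)
  qed
  show ge: "- 1 \<le> v u"
  proof (cases "c \<in> S")
    case True
    then have "P S = f c * P (S - {c})" using finite_subset_index[OF S] by (simp add: prod.remove)
    moreover have "S - {c} \<subseteq> A" using S by blast
    moreover have "poly (f c) 0 \<noteq> 0" "v (poly (f c) 0) < 2" using value_c_at_0 by (auto simp: val_ge_def)
    ultimately show ?thesis
      using at0 u P_at_0[of "S - {c}"] val_mult[of u "poly (f c) 0 * poly (P (S - {c})) 0"]
        val_mult[of "poly (f c) 0" "poly (P (S - {c})) 0"] by (auto simp: val_ge_def)
  qed (use c in simp)
  show "is_cover S" if neg: "v u < 0"
  proof -
    have "poly (P S) x \<in> \<MM>" if x: "x \<in> \<O>" for x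
    proof -
      have "u * poly (P S) x \<in> \<O>" using int x by (auto simp: Int_poly_def)
      then show ?thesis using neg u val_mult[of u "poly (P S) x"]
        by (cases "poly (P S) x = 0") (auto simp: val_pos_def val_ge_def)
    qed
    then show ?thesis using cover[OF S] unfolding is_cover_def by blast
  qed
qed

lemma Int_smult_P:
  assumes "S \<subseteq> insert c A" "is_cover S" "- 1 \<le> v u"
  shows "smult u (P S) \<in> Int_poly \<O>"
proof -
  have "u * poly (P S) x \<in> \<O>" if "x \<in> \<O>" for x
  proof -
    have "poly (P S) x \<in> val_ge v 1"
      using cover[OF assms(1)] assms(2) that unfolding is_cover_def val_pos_eq by blast
    then show ?thesis using val_ge_mult[of u "- 1" "poly (P S) x" 1] assms(3) by (simp add: val_ge_def)
  qed
  then show ?thesis by (simp add: Int_poly_def)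
qed

lemma is_cover_mincover: "is_cover (mincover j)"
  by (auto simp: is_cover_def mincover_def fibre_def)

lemma mincover_subset: "mincover j \<subseteq> insert c A"
  by (auto simp: mincover_def)

text \<open>
A cover that misses some \<open>a\<close> must contain all vertices outside the part of \<open>a\<close>.
\<close>

lemma cover_contains_mincover:
  assumes "is_cover S"
  shows "\<exists>j\<in>grp ` A. mincover j \<subseteq> S"
proof (cases "A \<subseteq> S")
  case True
  then show ?thesis using assms A_nonempty by (auto simp: is_cover_def mincover_def)
next
  case False
  then obtain a where "a \<in> A" "a \<notin> S" by blast
  then show ?thesis using assms by (intro bexI[of _ "grp a"]) (auto simp: is_cover_def mincover_def fibre_def)
qed

text \<open>
The part of \<open>j\<close> is nonempty, and any of its elements forces all vertices of the other parts into
the cover.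
\<close>

lemma mincover_minimal:
  assumes "j \<in> grp ` A" "is_cover S" "S \<subseteq> mincover j"
  shows "S = mincover j"
proof -
  obtain a where a: "a \<in> A" "grp a = j" using assms(1) by blast
  then have "a \<notin> S" using assms(3) c_notin by (auto simp: mincover_def fibre_def)
  then have "b \<in> S" if "b \<in> A" "grp b \<noteq> j" for b using a that assms(2) by (auto simp: is_cover_def)
  then have "mincover j \<subseteq> S" using assms(2) by (auto simp: mincover_def fibre_def is_cover_def)
  then show ?thesis using assms(3) by blast
qed

lemma Int_factor:
  assumes S: "S \<subseteq> insert c A" and u: "u \<noteq> 0" and ab: "a * b = smult u (P S)"
  obtains T \<alpha> \<beta> where "T \<subseteq> S" "\<alpha> \<noteq> 0" "\<beta> \<noteq> 0" "v \<alpha> + v \<beta> = v u"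
    "a = smult \<alpha> (P T)" "b = smult \<beta> (P (S - T))"
  using factor_of_product[OF finite_subset_index[OF S] _ u ab] irreducible_f S val_mult
  by (metis subsetD)

lemma irreducible_Int_f:
  assumes i: "i \<in> A"
  shows "ring_irreducible\<^bsub>IntR\<^esub> (f i)"
  unfolding irreducible_Int_iff[OF integral_f[OF insertI2[OF i]]]
proof (intro conjI ballI impI)
  have sub: "{i} \<subseteq> insert c A" using i by blast
  have "i \<noteq> c" using i c_notin by blast
  show "f i \<noteq> 0" using f_nonzero i by blast
  show "f i \<notin> Units IntR" using nonunit_of_degree_pos degree_f_pos i by blast
  fix a b assume a: "a \<in> Int_poly \<O>" and b: "b \<in> Int_poly \<O>" and eq: "f i = a * b"
  then have "a * b = smult 1 (P {i})" by simp
  then obtain T \<alpha> \<beta> where T: "T \<subseteq> {i}" "\<alpha> \<noteq> 0" "\<beta> \<noteq> 0" "v \<alpha> + v \<beta> = v 1"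
    "a = smult \<alpha> (P T)" "b = smult \<beta> (P ({i} - T))"
    using Int_factor[OF sub] by (metis one_neq_zero)
  have "T \<subseteq> insert c A" "{i} - T \<subseteq> insert c A" "c \<notin> T" "c \<notin> {i} - T"
    using T(1) i \<open>i \<noteq> c\<close> by auto
  then have "0 \<le> v \<alpha>" "0 \<le> v \<beta>"
    using Int_smult_P_imp(2)[of T \<alpha>] Int_smult_P_imp(2)[of "{i} - T" \<beta>] T a b by auto
  then have "v \<alpha> = 0" "v \<beta> = 0" using T(4) by auto
  moreover have "T = {} \<or> T = {i}" using T(1) by blast
  ultimately show "a \<in> Units IntR \<or> b \<in> Units IntR"
    unfolding Units_Int using T by (auto simp: smult_one)
qed

text \<open>
In a product of two factors, the one that contains \<open>f c\<close> carries the denominator, so its index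
set is a cover inside a minimal one and the other factor is a unit.
\<close>

lemma irreducible_Int_block:
  assumes j: "j \<in> grp ` A"
  shows "ring_irreducible\<^bsub>IntR\<^esub> (smult (inverse \<pi>) (P (mincover j)))"
proof -
  let ?u = "inverse \<pi>"
  have u: "?u \<noteq> 0" "v ?u = - 1" using uniformizer val_inverse by auto
  have int: "smult ?u (P (mincover j)) \<in> Int_poly \<O>"
    using u by (intro Int_smult_P mincover_subset is_cover_mincover) simp
  show ?thesis unfolding irreducible_Int_iff[OF int]
  proof (intro conjI ballI impI)
    show "smult ?u (P (mincover j)) \<noteq> 0" using P_nonzero[OF mincover_subset] u by simp
    have "0 < degree (P (mincover j))"
      using degree_P_pos[OF mincover_subset] by (simp add: mincover_def)
    then show "smult ?u (P (mincover j)) \<notin> Units IntR" using u by (intro nonunit_of_degree_pos) simp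
    fix a b assume a: "a \<in> Int_poly \<O>" and b: "b \<in> Int_poly \<O>" and eq: "smult ?u (P (mincover j)) = a * b"
    obtain T \<alpha> \<beta> where T: "T \<subseteq> mincover j" "\<alpha> \<noteq> 0" "\<beta> \<noteq> 0" "v \<alpha> + v \<beta> = v ?u"
      "a = smult \<alpha> (P T)" "b = smult \<beta> (P (mincover j - T))"
      using Int_factor[OF mincover_subset u(1) eq[symmetric]] by blast
    let ?T' = "mincover j - T"
    have sub: "T \<subseteq> insert c A" "?T' \<subseteq> insert c A" using T(1) mincover_subset by blast+
    note \<alpha> = Int_smult_P_imp[OF sub(1) T(2) a[unfolded T(5)]]
    note \<beta> = Int_smult_P_imp[OF sub(2) T(3) b[unfolded T(6)]]
    show "a \<in> Units IntR \<or> b \<in> Units IntR"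
    proof (cases "c \<in> T")
      case True
      then have v: "v \<alpha> < 0" "v \<beta> = 0" using \<alpha>(1) \<beta>(2) T(4) u(2) by auto
      then have "T = mincover j" using mincover_minimal[OF j \<alpha>(3)] T(1) by blast
      then show ?thesis unfolding Units_Int using T v by (auto simp: smult_one)
    next
      case False
      then have v: "v \<alpha> = 0" "v \<beta> < 0" using \<alpha>(2) \<beta>(1) T(4) u(2) by auto
      then have "?T' = mincover j" using mincover_minimal[OF j \<beta>(3)] by blast
      then have "T = {}" using T(1) by blast
      then show ?thesis unfolding Units_Int using T v by (auto simp: smult_one)
    qed
  qed
qed

lemma irreducible_smult_P_no_split:
  assumes irr: "ring_irreducible\<^bsub>IntR\<^esub> (smult \<alpha> (P T))" and \<alpha>: "\<alpha> \<noteq> 0" and T: "T \<subseteq> insert c A"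
    and S: "S \<subseteq> T" "S \<noteq> {}" and int: "smult \<alpha> (P S) \<in> Int_poly \<O>"
  shows "S = T"
proof (rule ccontr)
  assume "S \<noteq> T"
  then have ne: "T - S \<noteq> {}" using S by blast
  have sub: "S \<subseteq> insert c A" "T - S \<subseteq> insert c A" using S T by blast+
  have eq: "smult \<alpha> (P T) = smult \<alpha> (P S) * P (T - S)"
    using prod.subset_diff[OF S(1) finite_subset_index[OF T], of f] by (simp add: mult.commute)
  then have "smult \<alpha> (P T) \<in> Int_poly \<O>" using Int_mult[OF int Int_P[OF sub(2)]] by simp
  then have "smult \<alpha> (P S) \<in> Units IntR \<or> P (T - S) \<in> Units IntR"
    using irr eq int Int_P[OF sub(2)] by (auto simp: irreducible_Int_iff)
  moreover have "0 < degree (smult \<alpha> (P S))" "0 < degree (P (T - S))"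
    using degree_P_pos[OF sub(1) S(2)] degree_P_pos[OF sub(2) ne] \<alpha> by simp_all
  ultimately show False using nonunit_of_degree_pos by blast
qed

text \<open>
The core of the argument. The total value \<open>-1\<close> of the scalars is a sum of nonnegative numbers and
of one number that is at least \<open>-1\<close>, the scalar of the factor with \<open>f c\<close>. Hence this scalar is
\<open>1 / \<pi>\<close> up to a unit and all others are units. Irreducibility then reduces the cover to a minimal
one and the other index sets to singletons.
\<close>

lemma factorization_shape:
  assumes ps: "\<And>p. p \<in> set ps \<Longrightarrow> p \<in> Int_poly \<O> \<and> ring_irreducible\<^bsub>IntR\<^esub> p"
    and prod: "prod_list ps = smult (inverse \<pi>) (P (insert c A))"
  obtains j zs where "j \<in> grp ` A" "ps = map (\<lambda>(\<alpha>, T). smult \<alpha> (P T)) zs" "distinct (map snd zs)"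
    "set (map snd zs) = insert (mincover j) ((\<lambda>i. {i}) ` fibre j)"
    "\<forall>z\<in>set zs. fst z \<noteq> 0 \<and> v (fst z) = (if c \<in> snd z then - 1 else 0)"
proof -
  have u: "inverse \<pi> \<noteq> 0" "v (inverse \<pi>) = - 1" using uniformizer val_inverse by auto
  obtain zs where zs: "ps = map (\<lambda>(\<alpha>, T). smult \<alpha> (P T)) zs" "\<And>z. z \<in> set zs \<Longrightarrow> fst z \<noteq> 0"
    "prod_list (map fst zs) = inverse \<pi>" "\<Union>(snd ` set zs) = insert c A"
    "sorted_wrt (\<lambda>z z'. snd z \<inter> snd z' = {}) zs"
    using factors_of_product[OF finite_subset_index[OF order_refl] irreducible_f u(1) prod] by blast
  have elem: "smult (fst z) (P (snd z)) \<in> Int_poly \<O>" "ring_irreducible\<^bsub>IntR\<^esub> (smult (fst z) (P (snd z)))"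
    "snd z \<subseteq> insert c A" if "z \<in> set zs" for z
    using ps[of "smult (fst z) (P (snd z))"] zs(1,4) that by (force simp: case_prod_beta)+
  obtain z0 where z0: "z0 \<in> set zs" "c \<in> snd z0" using zs(4) by blast
  obtain xs ys where split: "zs = xs @ z0 # ys" using z0(1) split_list by metis
  define rest where "rest = xs @ ys"
  have set_zs: "set zs = insert z0 (set rest)" by (auto simp: rest_def split)
  have disj0: "snd z0 \<inter> snd z = {}" if "z \<in> set rest" for z
    using zs(5) that by (auto simp: split rest_def sorted_wrt_append)
  have val_prod: "v (prod_list (map fst ws)) = sum_list (map (v \<circ> fst) ws) \<and> prod_list (map fst ws) \<noteq> 0"
    if "set ws \<subseteq> set zs" for ws
    using that zs(2) by (induction ws) (auto simp: val_mult)
  have total: "v (fst z0) + sum_list (map (v \<circ> fst) rest) = - 1"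
    using val_prod[OF order_refl] zs(3) u(2) by (simp add: split rest_def)
  have "0 \<le> v (fst z)" if "z \<in> set rest" for z
    using Int_smult_P_imp(2)[of "snd z" "fst z"] elem[of z] zs(2)[of z] disj0[OF that] z0(2) that set_zs
    by blast
  then have nonneg: "\<forall>x\<in>set (map (v \<circ> fst) rest). 0 \<le> x" by auto
  have ge: "- 1 \<le> v (fst z0)" using Int_smult_P_imp(1) elem zs(2) z0(1) by blast
  then have "sum_list (map (v \<circ> fst) rest) = 0"
    using total sum_list_nonneg[of "map (v \<circ> fst) rest"] nonneg by fastforce
  then have v: "v (fst z0) = - 1" "\<And>z. z \<in> set rest \<Longrightarrow> v (fst z) = 0"
    using total sum_list_nonneg_eq_0_iff[of "map (v \<circ> fst) rest"] nonneg by auto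
  have "is_cover (snd z0)" using Int_smult_P_imp(3)[of "snd z0" "fst z0"] elem[of z0] zs(2) z0(1) v(1) by simp
  then obtain j where j: "j \<in> grp ` A" "mincover j \<subseteq> snd z0" using cover_contains_mincover by blast
  have "mincover j = snd z0"
    using elem[OF z0(1)] zs(2)[OF z0(1)] j(2) Int_smult_P[OF mincover_subset is_cover_mincover] v(1)
    by (intro irreducible_smult_P_no_split[of "fst z0"]) (auto simp: mincover_def)
  then have snd_z0: "snd z0 = mincover j" by simp
  have single: "\<exists>i. snd z = {i}" if z: "z \<in> set rest" for z
  proof -
    have mem: "z \<in> set zs" using z set_zs by blast
    have "snd z \<noteq> {}"
    proof
      assume "snd z = {}"
      then have "smult (fst z) (P (snd z)) \<in> Units IntR"
        unfolding Units_Int using zs(2)[OF mem] v(2)[OF z] by (auto simp: smult_one)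
      then show False using elem[OF mem] irreducible_Int_iff by blast
    qed
    then obtain i where i: "i \<in> snd z" by blast
    have "smult (fst z) (P {i}) \<in> Int_poly \<O>"
      using i elem(3)[OF mem] v(2)[OF z] by (intro Int_smult Int_P) (auto simp: val_ge_def)
    then have "{i} = snd z"
      using elem[OF mem] zs(2)[OF mem] i by (intro irreducible_smult_P_no_split[of "fst z"]) auto
    then show ?thesis by blast
  qed
  have Un: "\<Union>(snd ` set rest) = fibre j"
  proof -
    have "\<Union>(snd ` set rest) \<inter> mincover j = {}" using disj0 snd_z0 by blast
    moreover have "\<Union>(snd ` set rest) \<union> mincover j = insert c A" using zs(4) set_zs snd_z0 by auto
    ultimately have "\<Union>(snd ` set rest) = insert c A - mincover j" by blast
    then show ?thesis using c_notin by (auto simp: mincover_def fibre_def)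
  qed
  have "snd ` set rest = (\<lambda>i. {i}) ` fibre j"
  proof
    show "snd ` set rest \<subseteq> (\<lambda>i. {i}) ` fibre j" using single Un by blast
    show "(\<lambda>i. {i}) ` fibre j \<subseteq> snd ` set rest"
    proof
      fix T assume "T \<in> (\<lambda>i. {i}) ` fibre j"
      then obtain i where i: "i \<in> fibre j" "T = {i}" by blast
      then obtain z where "z \<in> set rest" "i \<in> snd z" using Un by blast
      then show "T \<in> snd ` set rest" using single[of z] i by auto
    qed
  qed
  then have set_eq: "set (map snd zs) = insert (mincover j) ((\<lambda>i. {i}) ` fibre j)"
    using set_zs snd_z0 by simp
  have ne: "snd z \<noteq> {}" if "z \<in> set zs" for z using that set_zs single[of z] z0(2) by auto
  have "distinct (map snd zs)"
    using zs(5) ne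
  proof (induction zs)
    case (Cons z zs)
    have "snd z \<noteq> {}" "\<forall>y\<in>set zs. snd z \<inter> snd y = {}" using Cons.prems by auto
    then have "snd z \<notin> snd ` set zs" by auto
    then show ?case using Cons by auto
  qed simp
  moreover have "fst z \<noteq> 0 \<and> v (fst z) = (if c \<in> snd z then - 1 else 0)" if "z \<in> set zs" for z
    using that set_zs zs(2)[of z] v(1) v(2)[of z] z0(2) disj0[of z] by auto
  ultimately show ?thesis using that j(1) zs(1) set_eq by blast
qed

text \<open>
The factorization belonging to the part \<open>j\<close>. The order of the factors is irrelevant, so an arbitrary
enumeration of the part is used.
\<close>

definition pieces :: "nat \<Rightarrow> 'a poly list" where
  "pieces j = smult (inverse \<pi>) (P (mincover j)) # map f (SOME xs. set xs = fibre j \<and> distinct xs)"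

lemma piecesE:
  obtains xs where "set xs = fibre j" "distinct xs"
    "pieces j = smult (inverse \<pi>) (P (mincover j)) # map f xs"
proof -
  have "finite (fibre j)" using finite_A by (simp add: fibre_def)
  then have "\<exists>xs. set xs = fibre j \<and> distinct xs" by (rule finite_distinct_list)
  from someI_ex[OF this] show ?thesis using that unfolding pieces_def by blast
qed

lemma length_pieces: "length (pieces j) = Suc (card (fibre j))"
  using piecesE[of j] distinct_card by (metis length_Cons length_map)

lemma factorization_pieces:
  assumes j: "j \<in> grp ` A"
  shows "factorization IntR (pieces j) (smult (inverse \<pi>) (P (insert c A)))"
proof -
  obtain xs where xs: "set xs = fibre j" "distinct xs"
    "pieces j = smult (inverse \<pi>) (P (mincover j)) # map f xs" by (rule piecesE)
  have fibre: "fibre j \<subseteq> A" by (auto simp: fibre_def)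
  have "v (inverse \<pi>) = - 1" using uniformizer val_inverse by auto
  then have "smult (inverse \<pi>) (P (mincover j)) \<in> Int_poly \<O>"
    by (intro Int_smult_P mincover_subset is_cover_mincover) simp
  then have "set (pieces j) \<subseteq> Int_poly \<O>" using xs fibre integral_f by auto
  moreover have "ring_irreducible\<^bsub>IntR\<^esub> a" if "a \<in> set (pieces j)" for a
    using that xs fibre irreducible_Int_f irreducible_Int_block[OF j] by auto
  moreover have "foldr (*) (pieces j) 1 = smult (inverse \<pi>) (P (insert c A))"
  proof -
    have "prod_list (map f xs) = P (fibre j)" using xs prod.distinct_set_conv_list[of xs f] by simp
    moreover have "P (insert c A) = P (mincover j) * P (fibre j)"
    proof -
      have "insert c A - fibre j = mincover j" using c_notin fibre by (auto simp: mincover_def)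
      then show ?thesis
        using prod.subset_diff[of "fibre j" "insert c A" f] fibre finite_A by auto
    qed
    ultimately show ?thesis by (simp add: xs(3) flip: prod_list.eq_foldr)
  qed
  ultimately show ?thesis unfolding factorization_def
    by (simp add: ring_of_type_algebra_def)
qed

lemma associated_smult:
  assumes "p \<in> Int_poly \<O>" "q \<in> Int_poly \<O>" "e \<noteq> 0" "v e = 0" "q = smult e p"
  shows "p \<sim>\<^bsub>IntR\<^esub> q"
proof -
  have "[:e:] \<in> Units IntR" unfolding Units_Int using assms by blast
  moreover have "q = [:e:] * p" using assms(5) by simp
  ultimately show ?thesis
    using domain.associated_iff_unit[OF Int_domain, of p q] assms(1,2) unfolding ring_on_simps by blast
qed

lemma associated_degree:
  assumes "p \<in> Int_poly \<O>" "q \<in> Int_poly \<O>" "p \<sim>\<^bsub>IntR\<^esub> q"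
  shows "degree p = degree q"
proof -
  obtain e where "e \<in> Units IntR" "q = e * p"
    using domain.associated_iff_unit[OF Int_domain, of p q] assms unfolding ring_on_simps by blast
  then show ?thesis by (auto simp: Units_Int)
qed

text \<open>
The index sets of the factors are the same as those of \<open>pieces j\<close>; as all of them are distinct, the
lists agree up to order, and the scalars differ by units.
\<close>

lemma factorization_essentially_pieces:
  assumes "factorization IntR ps (smult (inverse \<pi>) (P (insert c A)))"
  shows "\<exists>j\<in>grp ` A. essentially_equal IntR ps (pieces j)"
proof -
  have ps: "set ps \<subseteq> Int_poly \<O>" and elems: "\<And>p. p \<in> set ps \<Longrightarrow> p \<in> Int_poly \<O> \<and> ring_irreducible\<^bsub>IntR\<^esub> p"
    and prod: "prod_list ps = smult (inverse \<pi>) (P (insert c A))"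
    using assms unfolding factorization_def by (auto simp: ring_of_type_algebra_def prod_list.eq_foldr)
  obtain j zs where j: "j \<in> grp ` A" and zs: "ps = map (\<lambda>(\<alpha>, T). smult \<alpha> (P T)) zs"
    "distinct (map snd zs)" "set (map snd zs) = insert (mincover j) ((\<lambda>i. {i}) ` fibre j)"
    "\<forall>z\<in>set zs. fst z \<noteq> 0 \<and> v (fst z) = (if c \<in> snd z then - 1 else 0)"
    by (rule factorization_shape[OF elems prod])
  obtain xs where xs: "set xs = fibre j" "distinct xs"
    "pieces j = smult (inverse \<pi>) (P (mincover j)) # map f xs" by (rule piecesE)
  \<comment> \<open>The factor with index set \<open>T\<close> in normalized form: unit scalars are replaced by \<open>1\<close>.\<close>
  define canon where "canon T = (if c \<in> T then smult (inverse \<pi>) (P T) else P T)" for T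
  have fibre: "fibre j \<subseteq> A" "c \<notin> fibre j" using c_notin by (auto simp: fibre_def)
  have pieces: "pieces j = map canon (mincover j # map (\<lambda>i. {i}) xs)"
    using xs fibre by (auto simp: canon_def mincover_def)
  have "mincover j \<notin> (\<lambda>i. {i}) ` fibre j" using fibre by (auto simp: mincover_def)
  then have "distinct (mincover j # map (\<lambda>i. {i}) xs)"
    using xs by (auto simp: distinct_map inj_on_def)
  moreover have "set (mincover j # map (\<lambda>i. {i}) xs) = set (map snd zs)" using xs zs(3) by simp
  ultimately have "mset (mincover j # map (\<lambda>i. {i}) xs) = mset (map snd zs)"
    using zs(2) set_eq_iff_mset_eq_distinct by blast
  then have mset_eq: "mset (pieces j) = mset (map canon (map snd zs))"
    unfolding pieces mset_map by simp
  have pieces_carrier: "set (pieces j) \<subseteq> Int_poly \<O>"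
    using factorization_pieces[OF j] by (simp add: factorization_def)
  have "map canon (map snd zs) [\<sim>]\<^bsub>IntR\<^esub> ps"
  proof (unfold list_all2_conv_all_nth, intro conjI allI impI)
    show "length (map canon (map snd zs)) = length ps" by (simp add: zs(1))
    fix m assume "m < length (map canon (map snd zs))"
    then have m: "m < length zs" by simp
    let ?z = "zs ! m"
    have mem: "?z \<in> set zs" using m by simp
    have "canon (snd ?z) \<in> set (pieces j)"
      using mem mset_eq by (metis (no_types, lifting) image_eqI set_map set_mset_mset)
    then have 1: "canon (snd ?z) \<in> Int_poly \<O>" using pieces_carrier by blast
    have "ps ! m = smult (fst ?z) (P (snd ?z))" using m by (simp add: zs(1) case_prod_beta)
    moreover have "ps ! m \<in> Int_poly \<O>" using ps m zs(1) by (metis length_map nth_mem subsetD)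
    moreover have "fst ?z \<noteq> 0" "v (fst ?z) = (if c \<in> snd ?z then - 1 else 0)" using zs(4) mem by auto
    moreover have "v (fst ?z * \<pi>) = v (fst ?z) + 1" using \<open>fst ?z \<noteq> 0\<close> uniformizer by (simp add: val_mult)
    ultimately have "canon (snd ?z) \<sim>\<^bsub>IntR\<^esub> ps ! m"
      using uniformizer 1 by (intro associated_smult[where e = "if c \<in> snd ?z then fst ?z * \<pi> else fst ?z"])
        (auto simp: canon_def mult.assoc)
    then show "map canon (map snd zs) ! m \<sim>\<^bsub>IntR\<^esub> ps ! m" using m by simp
  qed
  then have "essentially_equal IntR (pieces j) ps"
    unfolding essentially_equal_def using mset_eq by blast
  then have "essentially_equal IntR ps (pieces j)"
    using monoid.ee_sym[of IntR "pieces j" ps] domain.axioms(1)[OF Int_domain] pieces_carrier ps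
    by (simp add: cring_def comm_monoid_def ring_def)
  then show ?thesis using j by blast
qed

text \<open>
Degrees separate the lists: for \<open>i\<close> in the part \<open>j\<close> the first list contains \<open>f i\<close>. In the second list
\<open>i\<close> and \<open>c\<close> both lie in the minimal cover, so that factor has larger degree, and the other factors
are \<open>f m\<close> with \<open>m \<noteq> i\<close>, whose degrees differ from that of \<open>f i\<close>.
\<close>

lemma pieces_not_essentially_equal:
  assumes j: "j \<in> grp ` A" "l \<in> grp ` A" "j \<noteq> l"
  shows "\<not> essentially_equal IntR (pieces j) (pieces l)"
proof
  assume "essentially_equal IntR (pieces j) (pieces l)"
  then obtain bs where bs: "mset (pieces j) = mset bs" "bs [\<sim>]\<^bsub>IntR\<^esub> pieces l"
    unfolding essentially_equal_def by blast
  have carrier: "set (pieces j) \<subseteq> Int_poly \<O>" "set (pieces l) \<subseteq> Int_poly \<O>"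
    using factorization_pieces j by (auto simp: factorization_def)
  obtain xs where xs: "set xs = fibre j" "pieces j = smult (inverse \<pi>) (P (mincover j)) # map f xs"
    by (rule piecesE)
  obtain ys where ys: "set ys = fibre l" "pieces l = smult (inverse \<pi>) (P (mincover l)) # map f ys"
    by (rule piecesE)
  obtain i where i: "i \<in> A" "grp i = j" using j by blast
  then have "f i \<in> set (pieces j)" using xs by (auto simp: fibre_def)
  then have "f i \<in> set bs" using bs(1) by (metis set_mset_mset)
  then obtain m where m: "m < length bs" "bs ! m = f i" by (auto simp: in_set_conv_nth)
  define p where "p = pieces l ! m"
  have p: "p \<in> set (pieces l)" "f i \<sim>\<^bsub>IntR\<^esub> p"
    using bs(2) m by (auto simp: list_all2_conv_all_nth p_def)
  then have deg: "degree (f i) = degree p"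
    using associated_degree carrier integral_f i(1) by blast
  consider "p = smult (inverse \<pi>) (P (mincover l))" | m where "m \<in> fibre l" "p = f m"
    using p(1) ys by auto
  then show False
  proof cases
    case 1
    have "i \<noteq> c" using i c_notin by blast
    have "{i, c} \<subseteq> mincover l" using i j by (auto simp: mincover_def fibre_def)
    then have "(\<Sum>m\<in>{i, c}. degree (f m)) \<le> degree (P (mincover l))"
      unfolding degree_P[OF mincover_subset]
      using finite_subset_index[OF mincover_subset] by (intro sum_mono2) auto
    then show False using 1 deg uniformizer degree_f_pos[of c] \<open>i \<noteq> c\<close> by simp
  next
    case 2
    then show False using deg inj_onD[OF inj_degree, of i m] i j by (auto simp: fibre_def)
  qed
qed

end

section \<open>Prescribed lengths of factorizations\<close>

theorem theorem1:
  fixes V W M_V M_W :: "'a::Fields.field set"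
    and w :: "'a \<Rightarrow> 'g::linordered_ab_group_add"
    and k :: nat and n :: "nat \<Rightarrow> nat"
  assumes "discrete_valuation_domain V"
    and "maximalideal M_V (ring_on V)"
    and "finite (carrier (ring_on V Quot M_V))"
    and "valuation w" and "W = valuation_ring w"
    and "maximalideal M_W (ring_on W)"
    and "independent_valuation_rings V W"
    and "(M_W \<noteq> {0} \<and> principalideal M_W (ring_on W)) \<or> finite (carrier (ring_on W Quot M_W))"
    and "1 \<le> k"
    and "\<forall>i\<in>{1..k}. 1 < n i"
    and "\<forall>i\<in>{1..k}. \<forall>j\<in>{1..k}. i \<le> j \<longrightarrow> n i \<le> n j"
  shows "\<exists>H\<in>Int_poly V. \<exists>F.
    essentially_distinct_factorizations (ring_on (Int_poly V)) H k F \<and>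
    (\<forall>i\<in>{1..k}. length (F i) = n i)"
proof -
  obtain v :: "'a \<Rightarrow> int" where v: "valuation v" "v ` (UNIV - {0}) = UNIV" "V = valuation_ring v"
    using assms(1) unfolding discrete_valuation_domain_def by blast
  interpret V: valued_field v by unfold_locales (rule v(1))
  interpret W: valued_field w by unfold_locales (rule assms(4))
  have V_eq: "V = val_ge v 0" and W_eq: "W = val_ge w 0"
    using v(3) assms(5) V.valuation_ring_eq W.valuation_ring_eq by auto
  have M_V: "M_V = val_pos v"
    using val_pos_eq_maximal_ideal[OF v(1)] assms(2) v(3) by blast
  have M_W: "M_W = val_pos w"
    using val_pos_eq_maximal_ideal[OF assms(4)] assms(5,6) by blast
  have "1 \<in> v ` (UNIV - {0})" unfolding v(2) by simp
  then obtain \<pi> where "\<pi> \<in> UNIV - {0}" "1 = v \<pi>" by blast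
  then have \<pi>: "\<pi> \<noteq> 0" "v \<pi> = 1" by simp_all
  have infinite: "infinite (UNIV :: 'a set)"
  proof
    assume "finite (UNIV :: 'a set)"
    then have "finite (v ` (UNIV - {0}))" by blast
    then show False using v(2) infinite_UNIV_int by simp
  qed
  have max_W: "maximalideal (val_pos w) (ring_on (val_ge w 0))"
    and residue_W: "(val_pos w \<noteq> {0} \<and> principalideal (val_pos w) (ring_on (val_ge w 0))) \<or>
      finite (carrier (ring_on (val_ge w 0) Quot val_pos w))"
    using assms(6,8) unfolding W_eq M_W by blast+
  note nontrivial = W.exists_positive_value[OF infinite max_W residue_W]
  note stable = W.stably_irreducible_exists[OF infinite max_W residue_W]
  obtain R where R: "finite R" "\<And>x. x \<in> val_ge v 0 \<Longrightarrow> \<exists>r\<in>R. x - r \<in> val_pos v"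
    using V.finite_residue_representatives assms(2,3) unfolding V_eq M_V by blast
  obtain N where N: "0 < N" "\<And>x. x \<in> val_ge v 0 \<Longrightarrow> x \<notin> val_pos v \<Longrightarrow> x ^ N - 1 \<in> val_pos v"
    using V.residue_exponent[OF R] by blast
  interpret two_valuations v w
    using assms(7) nontrivial \<pi> unfolding V_eq W_eq by unfold_locales auto
  interpret finite_residue_valued_field v \<pi> N
    using \<pi> N by unfold_locales auto
  \<comment> \<open>The part \<open>j\<close> consists of the pairs with first component \<open>j\<close>. As parts are numbered from \<open>1\<close>, the
  pair \<open>(0, 0)\<close> is available for the compulsory vertex.\<close>
  define A where "A = Sigma {1..k} (\<lambda>j. {..<n j - 1})"
  define c :: "nat \<times> nat" where "c = (0, 0)"
  define \<T> where "\<T> = {{a, b} |a b. a \<in> A \<and> b \<in> A \<and> fst a \<noteq> fst b}"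
  have finite_A: "finite A" and c_notin: "c \<notin> A" by (auto simp: A_def c_def)
  have finite_\<T>: "finite \<T>"
    by (rule finite_subset[of _ "(\<lambda>(a, b). {a, b}) ` (A \<times> A)"]) (use finite_A in \<open>auto simp: \<T>_def\<close>)
  have \<T>_sub: "\<Union>\<T> \<subseteq> A" by (auto simp: \<T>_def)
  have approx: "\<exists>f. (\<forall>i\<in>insert c A. Factorial_Ring.irreducible (f i) \<and> f i - F i \<in> coeffs_in (val_ge v 2)) \<and>
      inj_on (\<lambda>i. degree (f i)) (insert c A)" for F
    using finite_A by (intro irreducible_approximations stable) auto
  obtain f where f: "\<forall>i\<in>insert c A. Factorial_Ring.irreducible (f i) \<and> f i \<in> Int_poly (val_ge v 0)"
      "inj_on (\<lambda>i. degree (f i)) (insert c A)" "\<forall>i\<in>A. poly (f i) 0 \<notin> val_pos v" "poly (f c) 0 \<notin> val_ge v 2"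
      "\<forall>S\<subseteq>insert c A. (\<forall>x\<in>val_ge v 0. poly (\<Prod>i\<in>S. f i) x \<in> val_pos v) \<longleftrightarrow> c \<in> S \<and> (\<forall>T\<in>\<T>. S \<inter> T \<noteq> {})"
    using cover_polynomials[OF approx finite_A c_notin finite_\<T> \<T>_sub] by (elim exE conjE)
  have meets: "(\<forall>T\<in>\<T>. S \<inter> T \<noteq> {}) \<longleftrightarrow> (\<forall>a\<in>A. \<forall>b\<in>A. fst a \<noteq> fst b \<longrightarrow> a \<in> S \<or> b \<in> S)" for S
  proof (intro iffI ballI impI)
    fix a b assume *: "\<forall>T\<in>\<T>. S \<inter> T \<noteq> {}" and "a \<in> A" "b \<in> A" "fst a \<noteq> fst b"
    then have "{a, b} \<in> \<T>" unfolding \<T>_def by blast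
    then have "S \<inter> {a, b} \<noteq> {}" using * by blast
    then show "a \<in> S \<or> b \<in> S" by blast
  next
    fix T assume *: "\<forall>a\<in>A. \<forall>b\<in>A. fst a \<noteq> fst b \<longrightarrow> a \<in> S \<or> b \<in> S" and "T \<in> \<T>"
    then obtain a b where "T = {a, b}" "a \<in> A" "b \<in> A" "fst a \<noteq> fst b" unfolding \<T>_def by blast
    then show "S \<inter> T \<noteq> {}" using * by auto
  qed
  have fibres: "fst ` A = {1..k}"
  proof -
    have "(j, 0) \<in> A" if "j \<in> {1..k}" for j using that assms(10) by (auto simp: A_def)
    then show ?thesis by (force simp: A_def)
  qed
  interpret vertex_cover_family v \<pi> A c fst f
  proof unfold_locales
    show "A \<noteq> {}" using fibres assms(9) by auto
  qed (use finite_A c_notin f meets in auto)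
  have card: "Suc (card (fibre j)) = n j" if j: "j \<in> {1..k}" for j
  proof -
    have "fibre j = Pair j ` {..<n j - 1}" using j unfolding fibre_def by (auto simp: A_def)
    then have "card (fibre j) = n j - 1" by (simp add: card_image inj_on_def)
    moreover have "1 < n j" using assms(10) j by blast
    ultimately show ?thesis by simp
  qed
  let ?H = "smult (inverse \<pi>) (\<Prod>i\<in>insert c A. f i)"
  have "is_cover (insert c A)" by (simp add: is_cover_def)
  then have "?H \<in> Int_poly V"
    using Int_smult_P[of "insert c A" "inverse \<pi>"] V.val_inverse \<pi> unfolding V_eq by simp
  moreover have "essentially_distinct_factorizations (ring_on (Int_poly V)) ?H k pieces"
    unfolding essentially_distinct_factorizations_def V_eq
    using factorization_pieces pieces_not_essentially_equal factorization_essentially_pieces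
    unfolding fibres by blast
  moreover have "\<forall>i\<in>{1..k}. length (pieces i) = n i"
    using length_pieces card by simp
  ultimately show ?thesis by blast
qed

end
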